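(* Let $E^\omega$ be a nonautonomous affine set in $\mathbb R^d$ generated by nonsingular matrices $T_{k,i}$ ($1\le i\le n_k$, $k\ge1$) with $0<\alpha_-\le\alpha_+<1$, where $\alpha_+=\sup_{k,i}\alpha_1(T_{k,i})$ and $\alpha_-=\inf_{k,i}\alpha_d(T_{k,i})$. Let $\mu$ be a positive finite Borel measure on $\Sigma^\infty$, and let $\mu^\omega$ be its image measure under the projection $\Pi^\omega$. Then, for all $q>0$, $$\overline D_q(\mu^\omega)\le\min\{d_q^+,d\}\quad\text{and}\quad\underline D_q(\mu^\omega)\le\min\{d_q^-,d\}$$ for all $\omega$ (i.e. for every choice of translations fulfilling the nonautonomous structure), where $d_q^\pm$ are the critical values defined in the context via the singular value functions $\psi^s$.
   Context: **Words.** Let $\{n_k\}_{k\ge1}$ be integers $\ge2$; $\Sigma^k=\{u_1\cdots u_k:1\le u_j\le n_j\}$, $\Sigma^0=\{\emptyset\}$, $\Sigma^*=\bigcup_{k\ge0}\Sigma^k$, $\Sigma^\infty=\{u_1u_2\cdots:1\le u_k\le n_k\}$. For $\mathbf u=u_1\cdots u_k$ write $\mathbf u^-=u_1\cdots u_{k-1}$. $\mathcal C_{\mathbf u}\subset\Sigma^\infty$ is the cylinder of infinite words with prefix $\mathbf u$. **Nonautonomous affine set.** Let $J\subset\mathbb R^d$ be compact with non-empty interior and let $\Xi_k=\{T_{k,1},\dots,T_{k,n_k}\}$ be collections of $d\times d$ matrices with $\|T_{k,j}\|<1$. A collection $\{J_{\mathbf u}:\mathbf u\in\Sigma^*\}$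 of closed subsets of $J$ fulfils the nonautonomous structure if: (1) $J_\emptyset=J$ and $J_{\mathbf u1},\dots,J_{\mathbf un_k}\subset J_{\mathbf u}$ for all $\mathbf u\in\Sigma^{k-1}$; (2) for each $\mathbf u=u_1\cdots u_k$, $J_{\mathbf u}=\Psi_{u_1}\circ\cdots\circ\Psi_{u_k}(J)$, where $\Psi_{u_j}(x)=T_{j,u_j}x+\omega_{u_1\cdots u_j}$ for some $\omega_{u_1\cdots u_j}\in\mathbb R^d$; (3) $\lim_{k\to\infty}\max_{\mathbf u\in\Sigma^k}|J_{\mathbf u}|=0$ ($|\cdot|$ is diameter). Then $E^\omega=\bigcap_{k\ge1}\bigcup_{\mathbf u\in\Sigma^k}J_{\mathbf u}$. The projection $\Pi^\omega:\Sigma^\infty\to E^\omega$ sends $\mathbf u=u_1u_2\cdots$ to the unique point of $\bigcap_kJ_{u_1\cdots u_k}$, and $\mu^\omega(A)=\mu\{\mathbf u:\Pi^\omega(\mathbf u)\in A\}$. **Generalized $q$-dimensions.** Let $\mathcal M_r$ be the family of $r$-mesh cubes $[j_1r,(j_1+1)r)\times\cdots\times[j_dr,(j_d+1)r)$, $j_i\in\mathbb Z$. For a finite Borel measure $\nu$ on $\mathbb R^d$ and $q\ne1$, $\underline D_q(\nu)$ and $\overline D_q(\nu)$ are the $\liminf$ and $\limsup$ as $r\to0$ of $\frac{\log\sum_{Q\in\mathcal M_r}\nu(Q)^q}{(q-1)\log r}$; $\underline D_1(\nu)$ and $\overline D_1(\nu)$ are the $\liminf$ and $\limsup$ as $r\to0$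 of $\frac{\sum_{Q\in\mathcal M_r}\nu(Q)\log\nu(Q)}{\log r}$. **Singular value function.** For a contracting nonsingular linear $T$ with singular values $1>\alpha_1(T)\ge\cdots\ge\alpha_d(T)>0$: $\psi^s(T)=\alpha_1(T)\cdots\alpha_{m-1}(T)\alpha_m(T)^{s-m+1}$ for $0<s\le d$, where $m$ is the integer with $m-1<s\le m$; $\psi^0(T)=1$; and $\psi^s(T)=(\alpha_1(T)\cdots\alpha_d(T))^{s/d}$ for $s>d$. For $\mathbf u=u_1\cdots u_k$, $T_{\mathbf u}=T_{1,u_1}\cdots T_{k,u_k}$, with $T_\emptyset=I$. **Critical values.** For $s>0$, $0<r<1$, with $m$ the integer such that $m-1<s\le m$ (and $m=d$ if $s>d$), let $\Sigma^*(s,r)=\{\mathbf u\in\Sigma^*:\alpha_m(T_{\mathbf u})\le r<\alpha_m(T_{\mathbf u^-})\}$. Let $F_q(s,r)=\sum_{\mathbf u\in\Sigma^*(s,r)}\psi^s(T_{\mathbf u})^{1-q}\mu(\mathcal C_{\mathbf u})^q$ for $q\ne1$ and $F_1(s,r)=\sum_{\mathbf u\in\Sigma^*(s,r)}\mu(\mathcal C_{\mathbf u})\log\big(\psi^s(T_{\mathbf u})^{-1}\mu(\mathcal C_{\mathbf u})\big)$. Then - for $q\ge1$: $d_q^-=\sup\{s:\limsup_{r\to0}F_q(s,r)<\infty\}$, $d_q^+=\sup\{s:\liminf_{r\to0}F_q(s,r)<\infty\}$; - for $0<q<1$: $d_q^-=\inf\{s:\liminf_{r\to0}F_q(s,r)<\infty\}$,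 $d_q^+=\inf\{s:\limsup_{r\to0}F_q(s,r)<\infty\}$. Here $s$ ranges over $s>0$, with $\sup\emptyset=0$, $\inf\emptyset=+\infty$, $0\log0=0$.
   Formalization: For q = 1 the measure μ is assumed to have total mass at most 1; with the unnormalised D_1 the bound fails for larger mass (e.g. when μ^ω is twice Lebesgue measure on [0,1], D_1 = 2 while d_1^+ = d = 1). *)

theory Defs
  imports "HOL-Analysis.Analysis" "HOL-Computational_Algebra.Polynomial"
begin

section \<open>Words\<close>

text \<open>
  The data \<open>n k\<close> and \<open>T k j\<close> are used for \<open>k \<ge> 1\<close> and \<open>1 \<le> j \<le> n k\<close> only. Lists and
  sequences are indexed from 0, so \<open>u ! i\<close> (or \<open>w i\<close>) is the letter at level \<open>Suc i\<close>.
\<close>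

definition words :: "(nat \<Rightarrow> nat) \<Rightarrow> nat \<Rightarrow> nat list set" where
  "words n k = {u. length u = k \<and> (\<forall>i<k. u ! i \<in> {1..n (Suc i)})}"

definition finite_words :: "(nat \<Rightarrow> nat) \<Rightarrow> nat list set" where
  "finite_words n = (\<Union>k. words n k)"

definition infinite_words :: "(nat \<Rightarrow> nat) \<Rightarrow> (nat \<Rightarrow> nat) set" where
  "infinite_words n = {w. \<forall>i. w i \<in> {1..n (Suc i)}}"

definition word_prefix :: "(nat \<Rightarrow> nat) \<Rightarrow> nat \<Rightarrow> nat list" where
  "word_prefix w k = map w [0..<k]"

definition cylinder :: "(nat \<Rightarrow> nat) \<Rightarrow> nat list \<Rightarrow> (nat \<Rightarrow> nat) set" where
  "cylinder n u = {w \<in> infinite_words n. word_prefix w (length u) = u}"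


section \<open>Nonautonomous affine sets\<close>

text \<open>
  \<open>affine_comp T \<omega> u\<close> is the composition of the maps \<open>x \<mapsto> T j (u\<^sub>j) x + \<omega> (u\<^sub>1 \<dots> u\<^sub>j)\<close> for
  \<open>j = 1, \<dots>, length u\<close>; the map with \<open>j = 1\<close> is applied last.
\<close>

definition affine_comp ::
  "(nat \<Rightarrow> nat \<Rightarrow> real^'n^'n) \<Rightarrow> (nat list \<Rightarrow> real^'n) \<Rightarrow> nat list \<Rightarrow> real^'n \<Rightarrow> real^'n" where
  "affine_comp T \<omega> u =
     foldr (\<lambda>i f. (\<lambda>x. T (Suc i) (u ! i) *v x + \<omega> (take (Suc i) u)) \<circ> f) [0..<length u] id"

definition nonautonomous_structure ::
  "(nat \<Rightarrow> nat) \<Rightarrow> (nat \<Rightarrow> nat \<Rightarrow> real^'n^'n) \<Rightarrow> (real^'n) set \<Rightarrow> (nat list \<Rightarrow> real^'n)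
     \<Rightarrow> (nat list \<Rightarrow> (real^'n) set) \<Rightarrow> bool" where
  "nonautonomous_structure n T J \<omega> JJ \<longleftrightarrow>
     (\<forall>u\<in>finite_words n. closed (JJ u) \<and> JJ u \<subseteq> J) \<and>
     JJ [] = J \<and>
     (\<forall>u\<in>finite_words n. \<forall>j\<in>{1..n (Suc (length u))}. JJ (u @ [j]) \<subseteq> JJ u) \<and>
     (\<forall>u\<in>finite_words n. JJ u = affine_comp T \<omega> u ` J) \<and>
     (\<lambda>k. Max ((\<lambda>u. diameter (JJ u)) ` words n k)) \<longlonglongrightarrow> 0"

definition nonautonomous_set :: "(nat \<Rightarrow> nat) \<Rightarrow> (nat list \<Rightarrow> 'a set) \<Rightarrow> 'a set" where
  "nonautonomous_set n JJ = (\<Inter>k\<in>{1..}. \<Union>u\<in>words n k. JJ u)"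

definition word_proj :: "(nat list \<Rightarrow> 'a set) \<Rightarrow> (nat \<Rightarrow> nat) \<Rightarrow> 'a" where
  "word_proj JJ w = (THE x. x \<in> (\<Inter>k. JJ (word_prefix w k)))"

text \<open>The measure \<open>\<mu>\<^sup>\<omega>\<close>, as a Borel measure on the whole space.\<close>

definition image_measure ::
  "(nat list \<Rightarrow> (real^'n) set) \<Rightarrow> (nat \<Rightarrow> nat) measure \<Rightarrow> (real^'n) measure" where
  "image_measure JJ \<mu> = distr \<mu> borel (word_proj JJ)"


section \<open>Generalized dimensions\<close>

definition mesh_cubes :: "real \<Rightarrow> (real^'n) set set" where
  "mesh_cubes r =
     range (\<lambda>j :: int^'n. {x. \<forall>i. of_int (j $ i) * r \<le> x $ i \<and> x $ i < (of_int (j $ i) + 1) * r})"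

definition ln_ereal :: "ereal \<Rightarrow> ereal" where
  "ln_ereal x = (if x = \<infinity> then \<infinity> else if x \<le> 0 then -\<infinity> else ereal (ln (real_of_ereal x)))"

text \<open>
  The sums are taken in \<^typ>\<open>ereal\<close>, since for a measure with unbounded support they may diverge
  (to \<open>\<infinity>\<close> if \<open>0 < q < 1\<close>, to \<open>-\<infinity>\<close> if \<open>q = 1\<close>). Cubes of measure 0 contribute 0, as
  \<open>0 powr q = 0\<close> and \<open>0 * ln 0 = 0\<close>. The quotient for \<open>q = 1\<close> is not normalized by the total mass:
  \<open>D\<^sub>1 (c \<nu>) = c D\<^sub>1 (\<nu>)\<close> for \<open>c > 0\<close>, whereas \<open>D\<^sub>q (c \<nu>) = D\<^sub>q (\<nu>)\<close> for \<open>q \<noteq> 1\<close>.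
\<close>

definition mesh_quotient :: "real \<Rightarrow> (real^'n) measure \<Rightarrow> real \<Rightarrow> ereal" where
  "mesh_quotient q \<nu> r =
     (if q = 1
      then (\<Sum>\<^sub>\<infinity>Q\<in>mesh_cubes r. ereal (measure \<nu> Q * ln (measure \<nu> Q))) / ereal (ln r)
      else ln_ereal (\<Sum>\<^sub>\<infinity>Q\<in>mesh_cubes r. ereal (measure \<nu> Q powr q)) / ereal ((q - 1) * ln r))"

definition lower_dim :: "real \<Rightarrow> (real^'n) measure \<Rightarrow> ereal" where
  "lower_dim q \<nu> = Liminf (at_right 0) (mesh_quotient q \<nu>)"

definition upper_dim :: "real \<Rightarrow> (real^'n) measure \<Rightarrow> ereal" where
  "upper_dim q \<nu> = Limsup (at_right 0) (mesh_quotient q \<nu>)"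


section \<open>Singular values and the singular value function\<close>

definition charpoly :: "real^'n^'n \<Rightarrow> real poly" where
  "charpoly A = det (\<chi> i j. (if i = j then [:0, 1:] else 0) - [:A $ i $ j:])"

text \<open>
  The singular values of \<open>A\<close> are the square roots of the eigenvalues of \<open>A\<^sup>T A\<close>, counted with
  multiplicity; \<open>singular_value m A\<close> is the \<open>m\<close>-th largest one, for \<open>1 \<le> m \<le> CARD('n)\<close>.
\<close>

definition singular_values :: "real^'n^'n \<Rightarrow> real list" where
  "singular_values A =
     rev (sorted_list_of_multiset (image_mset sqrt (proots (charpoly (transpose A ** A)))))"

definition singular_value :: "nat \<Rightarrow> real^'n^'n \<Rightarrow> real" where
  "singular_value m A = singular_values A ! (m - 1)"

definition sv_fun :: "real \<Rightarrow> real^'n^'n \<Rightarrow> real" where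
  "sv_fun s A =
     (if s = 0 then 1
      else if s \<le> CARD('n) then
        (let m = nat \<lceil>s\<rceil>
         in (\<Prod>i=1..m-1. singular_value i A) * singular_value m A powr (s - real m + 1))
      else (\<Prod>i=1..CARD('n). singular_value i A) powr (s / CARD('n)))"

definition sv_sup :: "(nat \<Rightarrow> nat) \<Rightarrow> (nat \<Rightarrow> nat \<Rightarrow> real^'n^'n) \<Rightarrow> real" where
  "sv_sup n T = (SUP (k, i)\<in>Sigma {1..} (\<lambda>k. {1..n k}). singular_value 1 (T k i))"

definition sv_inf :: "(nat \<Rightarrow> nat) \<Rightarrow> (nat \<Rightarrow> nat \<Rightarrow> real^'n^'n) \<Rightarrow> real" where
  "sv_inf n T = (INF (k, i)\<in>Sigma {1..} (\<lambda>k. {1..n k}). singular_value CARD('n) (T k i))"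

definition word_matrix :: "(nat \<Rightarrow> nat \<Rightarrow> real^'n^'n) \<Rightarrow> nat list \<Rightarrow> real^'n^'n" where
  "word_matrix T u = foldr (\<lambda>i A. T (Suc i) (u ! i) ** A) [0..<length u] (mat 1)"


section \<open>Critical values\<close>

text \<open>
  The empty word, which has no predecessor, is never in the cut set, since all singular values of the
  identity exceed \<open>r < 1\<close>. If all \<open>T k i\<close> are nonsingular with norms bounded by a constant
  \<open>c < 1\<close>, the cut set is finite for \<open>s > 0\<close> and \<open>0 < r < 1\<close>.
\<close>

definition cut_set ::
  "(nat \<Rightarrow> nat) \<Rightarrow> (nat \<Rightarrow> nat \<Rightarrow> real^'n^'n) \<Rightarrow> real \<Rightarrow> real \<Rightarrow> nat list set" where
  "cut_set n T s r =
     (let m = min (nat \<lceil>s\<rceil>) CARD('n)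
      in {u \<in> finite_words n. u \<noteq> [] \<and> singular_value m (word_matrix T u) \<le> r \<and>
            r < singular_value m (word_matrix T (butlast u))})"

definition cut_sum ::
  "(nat \<Rightarrow> nat) \<Rightarrow> (nat \<Rightarrow> nat \<Rightarrow> real^'n^'n) \<Rightarrow> (nat \<Rightarrow> nat) measure \<Rightarrow> real \<Rightarrow> real \<Rightarrow> real \<Rightarrow> real"
  where
  "cut_sum n T \<mu> q s r =
     (if q = 1
      then (\<Sum>u\<in>cut_set n T s r.
              measure \<mu> (cylinder n u) *
                ln (inverse (sv_fun s (word_matrix T u)) * measure \<mu> (cylinder n u)))
      else (\<Sum>u\<in>cut_set n T s r.
              sv_fun s (word_matrix T u) powr (1 - q) * measure \<mu> (cylinder n u) powr q))"

text \<open>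
  Inserting 0 encodes \<open>sup \<emptyset> = 0\<close> (the supremum of the empty set in \<^typ>\<open>ereal\<close> is \<open>-\<infinity>\<close>).
\<close>

definition crit_minus ::
  "(nat \<Rightarrow> nat) \<Rightarrow> (nat \<Rightarrow> nat \<Rightarrow> real^'n^'n) \<Rightarrow> (nat \<Rightarrow> nat) measure \<Rightarrow> real \<Rightarrow> ereal" where
  "crit_minus n T \<mu> q =
     (if 1 \<le> q
      then Sup (insert 0 (ereal ` {s. 0 < s \<and> Limsup (at_right 0) (\<lambda>r. ereal (cut_sum n T \<mu> q s r)) < \<infinity>}))
      else Inf (ereal ` {s. 0 < s \<and> Liminf (at_right 0) (\<lambda>r. ereal (cut_sum n T \<mu> q s r)) < \<infinity>}))"

definition crit_plus ::
  "(nat \<Rightarrow> nat) \<Rightarrow> (nat \<Rightarrow> nat \<Rightarrow> real^'n^'n) \<Rightarrow> (nat \<Rightarrow> nat) measure \<Rightarrow> real \<Rightarrow> ereal" where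
  "crit_plus n T \<mu> q =
     (if 1 \<le> q
      then Sup (insert 0 (ereal ` {s. 0 < s \<and> Liminf (at_right 0) (\<lambda>r. ereal (cut_sum n T \<mu> q s r)) < \<infinity>}))
      else Inf (ereal ` {s. 0 < s \<and> Limsup (at_right 0) (\<lambda>r. ereal (cut_sum n T \<mu> q s r)) < \<infinity>}))"



section \<open>The projection is well defined\<close>

lemma word_prefix_words: "w \<in> infinite_words n \<Longrightarrow> word_prefix w k \<in> words n k"
  by (auto simp: word_prefix_def words_def infinite_words_def)

lemma finite_words_level: "finite (words n k)"
proof -
  have "words n k \<subseteq> {u. set u \<subseteq> (\<Union>i<k. {1..n (Suc i)}) \<and> length u = k}"
    unfolding words_def by (fastforce simp: in_set_conv_nth)
  moreover have "finite {u. set u \<subseteq> (\<Union>i<k. {1..n (Suc i)}) \<and> length u = k}"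
    by (intro finite_lists_length_eq) auto
  ultimately show ?thesis by (rule finite_subset)
qed

lemma word_proj_ex1:
  assumes S: "nonautonomous_structure n T J \<omega> JJ" and J: "compact J" "J \<noteq> {}"
    and w: "w \<in> infinite_words n"
  shows "\<exists>!x. x \<in> (\<Inter>k. JJ (word_prefix w k))"
proof -
  let ?F = "\<lambda>k. JJ (word_prefix w k)"
  have fw: "word_prefix w k \<in> finite_words n" for k
    using word_prefix_words[OF w] by (auto simp: finite_words_def)
  have cl: "closed (?F k)" for k
    using S fw[of k] unfolding nonautonomous_structure_def by blast
  have sub: "?F k \<subseteq> J" for k
    using S fw[of k] unfolding nonautonomous_structure_def by blast
  have im: "?F k = affine_comp T \<omega> (word_prefix w k) ` J" for k
    using S fw[of k] unfolding nonautonomous_structure_def by blast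
  have co: "compact (?F k)" for k
    using closed_Int_compact[OF cl[of k] J(1)] sub[of k] by (simp add: inf.absorb1)
  have ne: "?F k \<noteq> {}" for k using im J(2) by auto
  have step: "?F (Suc k) \<subseteq> ?F k" for k
  proof -
    have "w k \<in> {1..n (Suc (length (word_prefix w k)))}"
      using w by (auto simp: infinite_words_def word_prefix_def)
    moreover have "\<forall>j\<in>{1..n (Suc (length (word_prefix w k)))}. JJ (word_prefix w k @ [j]) \<subseteq> ?F k"
      using S fw[of k] unfolding nonautonomous_structure_def by blast
    ultimately have "JJ (word_prefix w k @ [w k]) \<subseteq> ?F k" by blast
    then show ?thesis by (simp add: word_prefix_def)
  qed
  have "\<Inter>(range ?F) \<noteq> {}"
    by (rule compact_nest[OF co ne]) (rule lift_Suc_antimono_le[of ?F, OF step])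
  then obtain x where x: "x \<in> (\<Inter>k. ?F k)" by blast
  have "y = x" if y: "y \<in> (\<Inter>k. ?F k)" for y
  proof -
    have le: "dist y x \<le> Max ((\<lambda>u. diameter (JJ u)) ` words n k)" for k
    proof -
      have "dist y x \<le> diameter (?F k)"
        using x y by (intro diameter_bounded_bound compact_imp_bounded co) auto
      also have "\<dots> \<le> Max ((\<lambda>u. diameter (JJ u)) ` words n k)"
        using word_prefix_words[OF w] finite_words_level by (intro Max_ge) auto
      finally show ?thesis .
    qed
    have "(\<lambda>k. Max ((\<lambda>u. diameter (JJ u)) ` words n k)) \<longlonglongrightarrow> 0"
      using S by (simp add: nonautonomous_structure_def)
    then have "dist y x \<le> 0" by (rule LIMSEQ_le_const) (use le in auto)
    then show ?thesis by simp
  qed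
  show ?thesis by (rule ex1I, rule x, fact)
qed

lemma word_proj_in_nonautonomous_set:
  assumes "nonautonomous_structure n T J \<omega> JJ" "compact J" "J \<noteq> {}" "w \<in> infinite_words n"
  shows "word_proj JJ w \<in> nonautonomous_set n JJ"
proof -
  have "word_proj JJ w \<in> (\<Inter>k. JJ (word_prefix w k))"
    unfolding word_proj_def by (rule theI'[OF word_proj_ex1[OF assms]])
  then show ?thesis
    using word_prefix_words[OF assms(4)] by (fastforce simp: nonautonomous_set_def)
qed

end

theory Submission
  imports Defs
begin

text \<open>
  For \<open>u\<close> in the cut set at scale \<open>r\<close> the piece \<open>J\<^sub>u\<close> lies in a box with sides of order
  \<open>\<alpha>\<^sub>i (T\<^sub>u)\<close>, and \<open>\<alpha>\<^sub>m (T\<^sub>u)\<close> is comparable to \<open>r\<close> because one more letter shrinks \<open>\<alpha>\<^sub>m\<close> at most by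
  the factor \<open>\<alpha>\<^sub>-\<close>. Hence \<open>J\<^sub>u\<close> meets at most \<open>C \<psi>\<^sup>s (T\<^sub>u) r\<^sup>-\<^sup>s\<close> mesh cubes. The cylinders of the cut set
  partition the infinite words, so the convexity or concavity of \<open>x\<^sup>q\<close> within each cylinder and its
  super- or subadditivity across cylinders bound \<open>F\<^sub>q (s, r)\<close> from above if \<open>q > 1\<close>, and from below if
  \<open>q < 1\<close>, by a constant times \<open>r\<^sup>s\<^sup>(\<^sup>1\<^sup>-\<^sup>q\<^sup>)\<close> times the mesh sum; for \<open>q = 1\<close> the function \<open>x ln x\<close> plays the same role. The bound by \<open>d\<close> is the case
  of the trivial partition, since \<open>J\<close> meets at most \<open>C r\<^sup>-\<^sup>d\<close> mesh cubes.
\<close>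

section \<open>Singular values\<close>

text \<open>At a fixed scale r the comparison of \<open>cut_sum\<close> with the mesh sum costs only
  a constant factor, which after taking logarithms and dividing by ln r becomes an error K / (- ln
  r) with K independent of r. So a bound on F_q valid for all small r yields the upper dimension and
  one valid at arbitrarily small r the lower dimension; this explains how limsup and liminf are
  paired with d_q^+ and d_q^-. The useful bound is F_q >= c for q >= 1 and F_q <= c for q < 1,
  because (q - 1) ln r changes sign at q = 1. For q = 1 the total mass M multiplies the logarithm of
  the cube count, so the estimate gives M s in place of s; this is where M <= 1 enters. As the
  dimensions never exceed d, exponents s > d never have to be compared with a mesh sum. The geometry
  needs singular values as axes of an ellipsoid and as min-max values, while they are defined by
  roots of a characteristic polynomial; the spectral theorem for symmetric operators links the
  two.\<close>

lemma symmetric_eigenvector: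
  fixes f :: "'a::euclidean_space \<Rightarrow> 'a"
  assumes f: "linear f" and sym: "\<And>x y. f x \<bullet> y = x \<bullet> f y"
    and S: "subspace S" "S \<noteq> {0}" and inv: "f ` S \<subseteq> S"
  obtains v c where "v \<in> S" "norm v = 1" "f v = c *\<^sub>R v"
proof -
  let ?K = "S \<inter> sphere 0 1"
  have "compact ?K"
    using closed_subspace[OF S(1)] by (intro closed_Int_compact) auto
  moreover have "?K \<noteq> {}"
  proof -
    obtain x where x: "x \<in> S" "x \<noteq> 0" using S subspace_0 by blast
    then have "x /\<^sub>R norm x \<in> ?K" using S(1) by (auto simp: subspace_scale)
    then show ?thesis by blast
  qed
  moreover have "continuous_on ?K (\<lambda>x. x \<bullet> f x)"
    using f by (intro continuous_intros linear_continuous_on) (simp add: linear_conv_bounded_linear)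
  \<comment> \<open>An eigenvector is found as a maximiser of the Rayleigh quotient on the unit
    sphere of \<open>S\<close>; the maximum becomes the eigenvalue.\<close>
  ultimately obtain v where v: "v \<in> ?K" and max: "\<And>x. x \<in> ?K \<Longrightarrow> x \<bullet> f x \<le> v \<bullet> f v"
    using continuous_attains_sup[of ?K "\<lambda>x. x \<bullet> f x"] by blast
  define c where "c = v \<bullet> f v"
  have le: "x \<bullet> f x \<le> c * (x \<bullet> x)" if "x \<in> S" for x
  proof (cases "x = 0")
    case False
    have "x /\<^sub>R norm x \<in> ?K" using False S(1) that by (auto simp: subspace_scale)
    from max[OF this] have "(x \<bullet> f x) / (norm x)\<^sup>2 \<le> c"
      by (simp add: c_def linear_scale[OF f] power2_eq_square divide_inverse mult_ac)
    then show ?thesis using False by (simp add: divide_le_eq power2_norm_eq_inner)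
  qed (use f in \<open>simp add: linear_0\<close>)
  \<comment> \<open>The eigenvector defect of \<open>v\<close>. It is half the gradient at
    \<open>v\<close> of the form c |x|^2 - x . f x, which is nonnegative on \<open>S\<close> and
    vanishes at \<open>v\<close>.\<close>
  define y where "y = c *\<^sub>R v - f v"
  have vS: "v \<in> S" and vn: "v \<bullet> v = 1" using v by (auto simp: norm_eq_1)
  have yS: "y \<in> S" using vS inv S(1) by (auto simp: y_def intro!: subspace_diff subspace_scale)
  define a where "a = c * (y \<bullet> y) - y \<bullet> f y"
  define b where "b = y \<bullet> y"
  \<comment> \<open>first variation of \<open>c |x|\<^sup>2 - x \<bullet> f x \<ge> 0\<close> at its zero \<open>v\<close>, in the direction \<open>y\<close>\<close>
  have var: "0 \<le> 2 * t * b + t\<^sup>2 * a" for t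
  proof -
    have "v + t *\<^sub>R y \<in> S" using vS yS S(1) by (intro subspace_add subspace_scale)
    from le[OF this] have "0 \<le> c * ((v + t *\<^sub>R y) \<bullet> (v + t *\<^sub>R y)) - (v + t *\<^sub>R y) \<bullet> f (v + t *\<^sub>R y)"
      by simp
    also have "\<dots> = 2 * t * (c * (v \<bullet> y) - f v \<bullet> y) + t\<^sup>2 * a"
    proof -
      have "v \<bullet> f y = f v \<bullet> y" "y \<bullet> f v = f v \<bullet> y" "y \<bullet> v = v \<bullet> y" "v \<bullet> f v = c"
        using sym[of v y] by (auto simp: inner_commute c_def)
      with vn have "(v + t *\<^sub>R y) \<bullet> f (v + t *\<^sub>R y) = c + 2 * t * (f v \<bullet> y) + t * t * (y \<bullet> f y)"
        "(v + t *\<^sub>R y) \<bullet> (v + t *\<^sub>R y) = 1 + 2 * t * (v \<bullet> y) + t * t * (y \<bullet> y)"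
        unfolding linear_add[OF f] linear_scale[OF f] inner_add_left inner_add_right inner_scaleR_left
          inner_scaleR_right by (simp_all add: distrib_left)
      then show ?thesis unfolding a_def power2_eq_square by algebra
    qed
    also have "c * (v \<bullet> y) - f v \<bullet> y = b" by (simp add: b_def y_def inner_diff_left)
    finally show ?thesis .
  qed
  have "b = 0"
  proof (rule ccontr)
    assume "b \<noteq> 0"
    then have b: "b > 0" by (simp add: b_def)
    \<comment> \<open>At t = - b / k the variation equals b^2 / k^2 * (a - 2 k), which is negative
      once k is positive and exceeds \<open>a\<close>.\<close>
    define k where "k = \<bar>a\<bar> + 1"
    have k: "k > 0" "a < k" by (auto simp: k_def)
    have "0 \<le> 2 * (- b / k) * b + (- b / k)\<^sup>2 * a" by (rule var)
    also have "\<dots> = b\<^sup>2 / k\<^sup>2 * (a - 2 * k)" using k by (simp add: field_simps power2_eq_square)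
    also have "\<dots> < 0" using b k by (intro mult_pos_neg) auto
    finally show False by simp
  qed
  then have "f v = c *\<^sub>R v" by (simp add: b_def y_def)
  with v that show ?thesis by auto
qed

text \<open>A largest orthonormal set of eigenvectors exists because independence bounds its size.
  Were it too small, its orthogonal complement would be nonzero and, by symmetry, invariant under
  \<open>f\<close>, hence would contain one more eigenvector.\<close>

lemma symmetric_orthonormal_eigenbasis:
  fixes f :: "'a::euclidean_space \<Rightarrow> 'a"
  assumes f: "linear f" and sym: "\<And>x y. f x \<bullet> y = x \<bullet> f y"
  obtains B where "finite B" "pairwise orthogonal B" "\<And>b. b \<in> B \<Longrightarrow> norm b = 1" "card B = DIM('a)"
    "\<And>b. b \<in> B \<Longrightarrow> \<exists>c. f b = c *\<^sub>R b"
proof -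
  define P where "P B \<longleftrightarrow> pairwise orthogonal B \<and> (\<forall>b\<in>B. norm b = 1 \<and> (\<exists>c. f b = c *\<^sub>R b))" for B
  have ind: "independent B" if "P B" for B
    using that by (intro pairwise_orthogonal_independent) (auto simp: P_def)
  have bound: "finite B \<and> card B \<le> DIM('a)" if "P B" for B
    using independent_bound[OF ind[OF that]] .
  have "P {}" by (simp add: P_def)
  then obtain B where B: "P B" and max: "\<And>C. P C \<Longrightarrow> card C \<le> card B"
    using ex_has_greatest_nat[of P "{}" card "Suc DIM('a)"] bound by (fastforce simp: less_Suc_eq_le)
  have "card B = DIM('a)"
  proof (rule ccontr)
    assume "card B \<noteq> DIM('a)"
    then have "dim B < DIM('a)" using bound[OF B] dim_eq_card_independent[OF ind[OF B]] by simp
    then obtain x where x: "x \<noteq> 0" "\<And>y. y \<in> span B \<Longrightarrow> orthogonal x y"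
      using orthogonal_to_subspace_exists[of B] by metis
    define S where "S = {x. \<forall>b\<in>B. x \<bullet> b = 0}"
    have S: "subspace S" by (auto simp: S_def subspace_def inner_add_left)
    have "x \<in> S" using x(2) by (auto simp: S_def orthogonal_def span_base)
    with x(1) have ne: "S \<noteq> {0}" by auto
    have inv: "f ` S \<subseteq> S"
    proof clarify
      fix y assume y: "y \<in> S"
      have "f y \<bullet> b = 0" if b: "b \<in> B" for b
      proof -
        obtain c where "f b = c *\<^sub>R b" using B b by (auto simp: P_def)
        then show ?thesis using sym[of y b] y b by (simp add: S_def)
      qed
      then show "f y \<in> S" by (simp add: S_def)
    qed
    obtain v c where v: "v \<in> S" "norm v = 1" "f v = c *\<^sub>R v"
      using symmetric_eigenvector[OF f sym S ne inv] by blast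
    have "v \<notin> B"
    proof
      assume "v \<in> B"
      with v(1) have "v \<bullet> v = 0" by (simp add: S_def)
      with v(2) show False by simp
    qed
    moreover have "P (insert v B)"
      using B v by (auto simp: P_def pairwise_insert S_def orthogonal_def inner_commute)
    ultimately show False using max[of "insert v B"] bound[OF B] by simp
  qed
  with B bound[OF B] that show ?thesis by (auto simp: P_def)
qed

section \<open>Eigenvalues with multiplicity and the singular value decomposition\<close>

lemma poly_charpoly:
  "poly (charpoly A) x = det (mat x - A)"
  by (auto simp: charpoly_def det_def poly_sum poly_prod mat_def intro!: sum.cong prod.cong)

text \<open>With the \<open>b j\<close> as columns of P, the matrix P^T M P is diagonal, and
  orthogonality gives (det P)^2 = 1.\<close>

lemma det_diagonal_orthonormal:
  fixes M :: "real^'n^'n" and b :: "'n \<Rightarrow> real^'n"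
  assumes b: "\<And>i j. b i \<bullet> b j = (if i = j then 1 else 0)"
    and M: "\<And>i. M *v b i = c i *\<^sub>R b i"
  shows "det M = (\<Prod>i\<in>UNIV. c i)"
proof -
  define P where "P = (\<chi> i j. b j $ i)"
  have "transpose P ** P = mat 1"
    using b by (simp add: vec_eq_iff matrix_matrix_mult_def transpose_def P_def mat_def inner_vec_def)
  then have "orthogonal_matrix P" by (simp add: orthogonal_matrix)
  then have P: "det P * det P = 1"
    using det_orthogonal_matrix by fastforce
  have "transpose P ** (M ** P) = (\<chi> i j. if i = j then c i else 0)"
  proof -
    have "(M ** P) $ i $ j = (M *v b j) $ i" for i j
      by (simp add: matrix_matrix_mult_def matrix_vector_mult_def P_def)
    then have "(transpose P ** (M ** P)) $ i $ j = b i \<bullet> (M *v b j)" for i j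
      by (unfold matrix_matrix_mult_def[of "transpose P"]) (simp add: transpose_def P_def inner_vec_def)
    then show ?thesis by (simp add: vec_eq_iff M b)
  qed
  moreover have "det (transpose P ** (M ** P)) = det M"
    using P by (simp add: det_mul)
  moreover have "det ((\<chi> i j. if i = j then c i else 0) :: real^'n^'n) = (\<Prod>i\<in>UNIV. c i)"
    by (subst det_diagonal) auto
  ultimately show ?thesis by simp
qed

text \<open>An eigenbasis of M also diagonalises x - M for every x, so the characteristic polynomial
  splits into the linear factors of the \<open>c i\<close>. This recovers the multiplicities on
  which the definition of \<open>singular_values\<close> depends.\<close>

lemma proots_charpoly:
  fixes M :: "real^'n^'n" and b :: "'n \<Rightarrow> real^'n"
  assumes b: "\<And>i j. b i \<bullet> b j = (if i = j then 1 else 0)"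
    and M: "\<And>i. M *v b i = c i *\<^sub>R b i"
  shows "proots (charpoly M) = image_mset c (mset_set UNIV)"
proof -
  have "charpoly M = (\<Prod>i\<in>UNIV. [:- c i, 1:])"
  proof (rule poly_ext)
    fix x
    have "(mat x - M) *v b i = (x - c i) *\<^sub>R b i" for i
      by (simp add: matrix_vector_mult_diff_rdistrib M scaleR_diff_left)
        (simp add: vec_eq_iff matrix_vector_mult_def mat_def if_distrib[of "\<lambda>z. z * _"] cong: if_cong)
    from det_diagonal_orthonormal[OF b this] show "poly (charpoly M) x = poly (\<Prod>i\<in>UNIV. [:- c i, 1:]) x"
      by (simp add: poly_charpoly poly_prod)
  qed
  moreover have "proots (\<Prod>i\<in>I. [:- c i, 1:]) = image_mset c (mset_set I)" if "finite I" for I :: "'n set"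
    using that by (induction I rule: finite_induct) (auto simp: proots_mult simp del: mult_pCons_left mult_pCons_right)
  ultimately show ?thesis by simp
qed

text \<open>\<open>v\<close> are the right singular vectors of \<open>A\<close>.\<close>

lemma singular_value_decomposition:
  fixes A :: "real^'n^'n"
  obtains v where
    "\<And>i j. i \<in> {1..CARD('n)} \<Longrightarrow> j \<in> {1..CARD('n)} \<Longrightarrow> v i \<bullet> v j = (if i = j then 1 else 0)"
    "\<And>i j. i \<in> {1..CARD('n)} \<Longrightarrow> j \<in> {1..CARD('n)} \<Longrightarrow>
       (A *v v i) \<bullet> (A *v v j) = (if i = j then (singular_value i A)\<^sup>2 else 0)"
    "\<And>i. i \<in> {1..CARD('n)} \<Longrightarrow> 0 \<le> singular_value i A"
    "\<And>i j. 1 \<le> i \<Longrightarrow> i \<le> j \<Longrightarrow> j \<le> CARD('n) \<Longrightarrow> singular_value j A \<le> singular_value i A"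
proof -
  define f where "f x = (transpose A ** A) *v x" for x
  have fA: "f x \<bullet> y = (A *v x) \<bullet> (A *v y)" for x y
    by (metis f_def dot_lmul_matrix inner_commute matrix_vector_mul_assoc transpose_matrix_vector)
  have f: "linear f" unfolding f_def by (rule matrix_vector_mul_linear)
  have sym: "f x \<bullet> y = x \<bullet> f y" for x y by (metis fA inner_commute)
  obtain B where B: "finite B" "pairwise orthogonal B" "\<And>b. b \<in> B \<Longrightarrow> norm b = 1"
    "card B = DIM(real^'n)" "\<And>b. b \<in> B \<Longrightarrow> \<exists>c. f b = c *\<^sub>R b"
    using symmetric_orthonormal_eigenbasis[OF f sym] by metis
  obtain b :: "'n \<Rightarrow> real^'n" where b: "bij_betw b UNIV B"
    using finite_same_card_bij[of "UNIV :: 'n set" B] B by auto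
  have orth: "b i \<bullet> b j = (if i = j then 1 else 0)" for i j
  proof -
    have "b i \<in> B" "b j \<in> B" "b i = b j \<longleftrightarrow> i = j" using b by (auto simp: bij_betw_def inj_def)
    then show ?thesis using B(2,3) by (auto simp: pairwise_def orthogonal_def norm_eq_1)
  qed
  have "\<forall>i. \<exists>c. f (b i) = c *\<^sub>R b i" using B(5) b by (auto simp: bij_betw_def)
  then obtain c where c: "\<And>i. f (b i) = c i *\<^sub>R b i" by metis
  have Ab: "(A *v b i) \<bullet> (A *v b j) = (if i = j then c i else 0)" for i j
    using fA[of "b i" "b j"] by (cases "i = j") (simp_all add: c orth)
  have c0: "0 \<le> c i" for i using Ab[of i i] inner_ge_zero[of "A *v b i"] by simp
  have pr: "proots (charpoly (transpose A ** A)) = image_mset c (mset_set UNIV)"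
    using orth c by (intro proots_charpoly[where b = b]) (auto simp: f_def)
  obtain xs :: "'n list" where xs: "set xs = UNIV" "distinct xs"
    using finite_distinct_list[of "UNIV :: 'n set"] by auto
  define g where "g = (\<lambda>i. sqrt (c i))"
  \<comment> \<open>Sorting the indices instead of the values remembers which eigenvector belongs to
    each entry of \<open>singular_values A\<close>.\<close>
  define ys where "ys = rev (sort_key g xs)"
  have sort: "sort (map g xs) = map g (sort_key g xs)"
    by (rule properties_for_sort) auto
  have "image_mset sqrt (proots (charpoly (transpose A ** A))) = mset (map g xs)"
    using xs by (simp add: pr g_def mset_set_set[symmetric] image_mset.compositionality o_def)
  then have sv: "singular_values A = map g ys"
    by (simp only: singular_values_def ys_def rev_map[symmetric] sort[symmetric] sorted_list_of_multiset_mset)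
  have ys: "distinct ys" "length ys = CARD('n)"
    using xs distinct_card[of xs] by (auto simp: ys_def)
  have svi: "singular_value i A = g (ys ! (i - 1))" if "i \<in> {1..CARD('n)}" for i
    using that ys by (auto simp: singular_value_def sv)
  have desc: "g (ys ! j) \<le> g (ys ! i)" if "i \<le> j" "j < CARD('n)" for i j
  proof -
    have "sorted_wrt (\<ge>) (map g ys)"
      by (simp add: ys_def rev_map[symmetric] sorted_wrt_rev)
    with that ys show ?thesis
      by (cases "i = j") (auto simp: sorted_wrt_iff_nth_less)
  qed
  show thesis
  proof (rule that[of "\<lambda>i. b (ys ! (i - 1))"])
    fix i j assume ij: "i \<in> {1..CARD('n)}" "j \<in> {1..CARD('n)}"
    then have "ys ! (i - 1) = ys ! (j - 1) \<longleftrightarrow> i - 1 = j - 1"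
      using nth_eq_iff_index_eq[OF ys(1), of "i - 1" "j - 1"] ys(2) by auto
    also have "\<dots> \<longleftrightarrow> i = j" using ij by auto
    finally have eq: "ys ! (i - 1) = ys ! (j - 1) \<longleftrightarrow> i = j" .
    show "b (ys ! (i - 1)) \<bullet> b (ys ! (j - 1)) = (if i = j then 1 else 0)"
      by (simp add: orth eq del: One_nat_def)
    show "(A *v b (ys ! (i - 1))) \<bullet> (A *v b (ys ! (j - 1))) = (if i = j then (singular_value i A)\<^sup>2 else 0)"
      using c0 by (simp add: Ab eq svi[OF ij(1)] svi[OF ij(2)] g_def del: One_nat_def)
  next
    fix i assume "i \<in> {1..CARD('n)}"
    then show "0 \<le> singular_value i A" by (simp add: svi g_def c0)
  next
    fix i j assume "1 \<le> i" "i \<le> j" "j \<le> CARD('n)"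
    then show "singular_value j A \<le> singular_value i A" by (subst (1 2) svi) (auto intro!: desc)
  qed
qed

lemma orthonormal_family_subset:
  fixes v :: "nat \<Rightarrow> 'a::euclidean_space"
  assumes v: "\<And>i j. i \<in> {1..DIM('a)} \<Longrightarrow> j \<in> {1..DIM('a)} \<Longrightarrow> v i \<bullet> v j = (if i = j then 1 else 0)"
    and I: "I \<subseteq> {1..DIM('a)}"
  shows "inj_on v I" "independent (v ` I)" "dim (span (v ` I)) = card I"
proof -
  show inj: "inj_on v I"
  proof (rule inj_onI)
    fix i j assume "i \<in> I" "j \<in> I" "v i = v j"
    then show "i = j" using v[of i j] v[of i i] I by (cases "i = j") (auto simp: subset_iff)
  qed
  have "v i \<noteq> 0" if "i \<in> I" for i using v[of i i] that I by auto
  then show ind: "independent (v ` I)"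
  proof (intro pairwise_orthogonal_independent pairwiseI)
    fix x y assume "x \<in> v ` I" "y \<in> v ` I" "x \<noteq> y"
    then show "orthogonal x y" using v I by (auto simp: orthogonal_def subset_iff)
  qed auto
  then show "dim (span (v ` I)) = card I"
    using inj by (simp add: dim_eq_card_independent card_image)
qed

lemma orthonormal_expansion:
  fixes v :: "nat \<Rightarrow> 'a::euclidean_space"
  assumes v: "\<And>i j. i \<in> {1..DIM('a)} \<Longrightarrow> j \<in> {1..DIM('a)} \<Longrightarrow> v i \<bullet> v j = (if i = j then 1 else 0)"
    and I: "I \<subseteq> {1..DIM('a)}" and x: "x \<in> span (v ` I)"
  shows "x = (\<Sum>i\<in>I. (x \<bullet> v i) *\<^sub>R v i)"
proof -
  have fin: "finite I" using I finite_subset by auto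
  obtain u where "x = (\<Sum>y\<in>v ` I. u y *\<^sub>R y)"
    using x fin by (auto simp: span_finite)
  then obtain c where c: "x = (\<Sum>i\<in>I. c i *\<^sub>R v i)"
    using sum.reindex[OF orthonormal_family_subset(1)[OF v I], of "\<lambda>y. u y *\<^sub>R y"] by auto
  have "x \<bullet> v j = c j" if j: "j \<in> I" for j
  proof -
    have "x \<bullet> v j = (\<Sum>i\<in>I. if i = j then c i else 0)"
      unfolding c inner_sum_left using v j I by (intro sum.cong) (auto simp: subset_iff)
    then show ?thesis using j fin by simp
  qed
  then show ?thesis using c by simp
qed

lemma orthonormal_family_span:
  fixes v :: "nat \<Rightarrow> 'a::euclidean_space"
  assumes v: "\<And>i j. i \<in> {1..DIM('a)} \<Longrightarrow> j \<in> {1..DIM('a)} \<Longrightarrow> v i \<bullet> v j = (if i = j then 1 else 0)"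
  shows "span (v ` {1..DIM('a)}) = UNIV"
  using orthonormal_family_subset(3)[OF v order_refl] by (simp add: dim_eq_full)

text \<open>\<open>V\<close> and \<open>W\<close> are the spans of the first \<open>m\<close> and of the last \<open>d + 1 - m\<close> right singular vectors.\<close>

lemma singular_value_subspaces:
  fixes A :: "real^'n^'n"
  assumes m: "m \<in> {1..CARD('n)}"
  obtains V W where "subspace V" "dim V = m" "\<And>x. x \<in> V \<Longrightarrow> singular_value m A * norm x \<le> norm (A *v x)"
    "subspace W" "dim W = CARD('n) + 1 - m" "\<And>x. x \<in> W \<Longrightarrow> norm (A *v x) \<le> singular_value m A * norm x"
proof -
  obtain v where v: "\<And>i j. i \<in> {1..CARD('n)} \<Longrightarrow> j \<in> {1..CARD('n)} \<Longrightarrow> v i \<bullet> v j = (if i = j then 1 else 0)"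
    and Av: "\<And>i j. i \<in> {1..CARD('n)} \<Longrightarrow> j \<in> {1..CARD('n)} \<Longrightarrow>
       (A *v v i) \<bullet> (A *v v j) = (if i = j then (singular_value i A)\<^sup>2 else 0)"
    and nn: "\<And>i. i \<in> {1..CARD('n)} \<Longrightarrow> 0 \<le> singular_value i A"
    and anti: "\<And>i j. 1 \<le> i \<Longrightarrow> i \<le> j \<Longrightarrow> j \<le> CARD('n) \<Longrightarrow> singular_value j A \<le> singular_value i A"
    by (rule singular_value_decomposition[of A], rule that)
  have d: "DIM(real^'n) = CARD('n)" by simp
  note v' = v[folded d]
  \<comment> \<open>In right singular coordinates both norms are sums of the same squares, the
    second one weighted by squared singular values; on the span of \<open>I\<close> their ratio lies
    between the extreme singular values with index in \<open>I\<close>.\<close>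
  have nx: "(norm x)\<^sup>2 = (\<Sum>i\<in>I. (x \<bullet> v i)\<^sup>2)"
    and nAx: "(norm (A *v x))\<^sup>2 = (\<Sum>i\<in>I. (singular_value i A)\<^sup>2 * (x \<bullet> v i)\<^sup>2)"
    if I: "I \<subseteq> {1..CARD('n)}" and x: "x \<in> span (v ` I)" for I x
  proof -
    have fin: "finite I" using I finite_subset by auto
    define c where "c i = x \<bullet> v i" for i
    have e: "x = (\<Sum>i\<in>I. c i *\<^sub>R v i)"
      using orthonormal_expansion[OF v' _ x] I by (simp add: c_def)
    have Ax: "A *v x = (\<Sum>i\<in>I. c i *\<^sub>R (A *v v i))"
      by (subst e) (simp add: linear_sum[OF matrix_vector_mul_linear] linear_scale[OF matrix_vector_mul_linear])
    have "x \<bullet> x = (\<Sum>i\<in>I. c i * (v i \<bullet> x))" by (subst e) (simp add: inner_sum_left)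
    then show "(norm x)\<^sup>2 = (\<Sum>i\<in>I. (x \<bullet> v i)\<^sup>2)"
 unfolding power2_norm_eq_inner
      by (simp only: c_def inner_commute[of "v _"] power2_eq_square)
    have "(A *v v i) \<bullet> (A *v x) = c i * (singular_value i A)\<^sup>2" if i: "i \<in> I" for i
    proof -
      have "(A *v v i) \<bullet> (A *v x) = (\<Sum>j\<in>I. if j = i then c j * (singular_value i A)\<^sup>2 else 0)"
        unfolding Ax inner_sum_right using i I by (intro sum.cong) (auto simp: Av subset_iff)
      then show ?thesis using fin i by simp
    qed
    then have "(A *v x) \<bullet> (A *v x) = (\<Sum>i\<in>I. c i * (c i * (singular_value i A)\<^sup>2))"
      by (subst Ax) (simp add: inner_sum_left)
    then show "(norm (A *v x))\<^sup>2 = (\<Sum>i\<in>I. (singular_value i A)\<^sup>2 * (x \<bullet> v i)\<^sup>2)"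
      unfolding power2_norm_eq_inner by (simp add: c_def power2_eq_square mult_ac)
  qed
  let ?V = "{1..m}" and ?W = "{m..CARD('n)}"
  have sub: "?V \<subseteq> {1..CARD('n)}" "?W \<subseteq> {1..CARD('n)}" using m by auto
  note mono = power_mono[OF anti nn]
  show thesis
  proof (rule that)
    show "dim (span (v ` ?V)) = m" "dim (span (v ` ?W)) = CARD('n) + 1 - m"
      using orthonormal_family_subset(3)[OF v'] sub by simp_all
    fix x
    {
      assume x: "x \<in> span (v ` ?V)"
      have "(singular_value m A * norm x)\<^sup>2 = (\<Sum>i\<in>?V. (singular_value m A)\<^sup>2 * (x \<bullet> v i)\<^sup>2)"
        by (simp add: power_mult_distrib nx[OF sub(1) x] sum_distrib_left)
      also have "\<dots> \<le> (norm (A *v x))\<^sup>2"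
        unfolding nAx[OF sub(1) x] using m by (intro sum_mono mult_right_mono mono) auto
      finally show "singular_value m A * norm x \<le> norm (A *v x)" by (rule power2_le_imp_le) simp
    next
      assume x: "x \<in> span (v ` ?W)"
      have "(norm (A *v x))\<^sup>2 \<le> (\<Sum>i\<in>?W. (singular_value m A)\<^sup>2 * (x \<bullet> v i)\<^sup>2)"
        unfolding nAx[OF sub(2) x] using m by (intro sum_mono mult_right_mono mono) auto
      also have "\<dots> = (singular_value m A * norm x)\<^sup>2"
        by (simp add: power_mult_distrib nx[OF sub(2) x] sum_distrib_left)
      finally show "norm (A *v x) \<le> singular_value m A * norm x"
        by (rule power2_le_imp_le) (use nn[OF m] in simp)
    }
  qed auto
qed

section \<open>Min-max principle and products of matrices\<close>

lemma singular_value_antimono: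
  fixes A :: "real^'n^'n"
  shows "1 \<le> i \<Longrightarrow> i \<le> j \<Longrightarrow> j \<le> CARD('n) \<Longrightarrow> singular_value j A \<le> singular_value i A"
  by (rule singular_value_decomposition[of A]) blast

lemma singular_value_nonneg:
  fixes A :: "real^'n^'n"
  shows "m \<in> {1..CARD('n)} \<Longrightarrow> 0 \<le> singular_value m A"
  by (rule singular_value_decomposition[of A]) blast

text \<open>One half of the Courant-Fischer principle: \<open>V\<close> and the space
  \<open>W\<close> for the last d + 1 - m singular vectors have dimensions adding up to more than d,
  so they share a nonzero vector, on which the two bounds can be compared.\<close>

lemma singular_value_ge:
  fixes A :: "real^'n^'n"
  assumes m: "m \<in> {1..CARD('n)}" and V: "subspace V" "m \<le> dim V"
    and le: "\<And>x. x \<in> V \<Longrightarrow> t * norm x \<le> norm (A *v x)"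
  shows "t \<le> singular_value m A"
proof -
  obtain W where W: "subspace W" "dim W = CARD('n) + 1 - m"
    "\<And>x. x \<in> W \<Longrightarrow> norm (A *v x) \<le> singular_value m A * norm x"
    using singular_value_subspaces[OF m, of A] by metis
  have "dim {x + y |x y. x \<in> V \<and> y \<in> W} \<le> CARD('n)"
    using dim_subset_UNIV[of "{x + y |x y. x \<in> V \<and> y \<in> W}"] by simp
  with dim_sums_Int[OF V(1) W(1)] V(2) W(2) m have "0 < dim (V \<inter> W)"
    by (simp del: dim_eq_0)
  then have "\<not> V \<inter> W \<subseteq> {0}" using dim_eq_0[of "V \<inter> W"] by linarith
  then obtain x where x: "x \<in> V" "x \<in> W" "x \<noteq> 0" by auto
  from le[OF x(1)] W(3)[OF x(2)] have "t * norm x \<le> singular_value m A * norm x" by linarith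
  with x(3) show ?thesis by simp
qed

lemma norm_matrix_vector_le:
  fixes A :: "real^'n^'n"
  shows "norm (A *v x) \<le> singular_value 1 A * norm x"
proof -
  have 1: "1 \<in> {1..CARD('n)}" by simp
  obtain W where W: "subspace W" "dim W = CARD('n)" "\<And>x. x \<in> W \<Longrightarrow> norm (A *v x) \<le> singular_value 1 A * norm x"
    using singular_value_subspaces[OF 1, of A] by (metis add_diff_cancel_right')
  then have "span W = UNIV" using dim_eq_full[of W] by simp
  with W(1) have "W = UNIV" by (metis span_eq_iff)
  with W(3) show ?thesis by auto
qed

lemma norm_matrix_vector_ge:
  fixes A :: "real^'n^'n"
  shows "singular_value CARD('n) A * norm x \<le> norm (A *v x)"
proof -
  have 1: "CARD('n) \<in> {1..CARD('n)}" by simp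
  obtain V where V: "subspace V" "dim V = CARD('n)" "\<And>x. x \<in> V \<Longrightarrow> singular_value CARD('n) A * norm x \<le> norm (A *v x)"
    using singular_value_subspaces[OF 1, of A] by metis
  then have "span V = UNIV" using dim_eq_full[of V] by simp
  with V(1) have "V = UNIV" by (metis span_eq_iff)
  with V(3) show ?thesis by auto
qed

lemma singular_value_1_le:
  fixes A :: "real^'n^'n"
  assumes "\<And>x. norm (A *v x) \<le> c * norm x"
  shows "singular_value 1 A \<le> c"
proof -
  have 1: "1 \<in> {1..CARD('n)}" by simp
  obtain V where V: "dim V = 1" "\<And>x. x \<in> V \<Longrightarrow> singular_value 1 A * norm x \<le> norm (A *v x)"
    using singular_value_subspaces[OF 1, of A] by metis
  then obtain x where x: "x \<in> V" "x \<noteq> 0" using dim_eq_0[of V] by fastforce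
  have "singular_value 1 A * norm x \<le> c * norm x" using V(2)[OF x(1)] assms[of x] by linarith
  with x(2) show ?thesis by simp
qed

lemma singular_value_mult_1_le:
  fixes A B :: "real^'n^'n"
  shows "singular_value 1 (A ** B) \<le> singular_value 1 A * singular_value 1 B"
proof (rule singular_value_1_le)
  fix x
  have "norm ((A ** B) *v x) \<le> singular_value 1 A * norm (B *v x)"
    by (metis matrix_vector_mul_assoc norm_matrix_vector_le)
  also have "\<dots> \<le> singular_value 1 A * (singular_value 1 B * norm x)"
    by (intro mult_left_mono norm_matrix_vector_le singular_value_nonneg) simp
  finally show "norm ((A ** B) *v x) \<le> singular_value 1 A * singular_value 1 B * norm x" by simp
qed

text \<open>The test space is the preimage under B of an m-dimensional space on which A shrinks by
  at most its m-th singular value; B itself shrinks by at most its smallest one.\<close>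

lemma singular_value_mult_ge:
  fixes A B :: "real^'n^'n"
  assumes m: "m \<in> {1..CARD('n)}" and B: "invertible B"
  shows "singular_value m A * singular_value CARD('n) B \<le> singular_value m (A ** B)"
proof -
  obtain V where V: "subspace V" "dim V = m" "\<And>x. x \<in> V \<Longrightarrow> singular_value m A * norm x \<le> norm (A *v x)"
    using singular_value_subspaces[OF m, of A] by metis
  obtain B' where "B ** B' = mat 1" "B' ** B = mat 1" using B by (auto simp: invertible_def)
  then have B': "B *v (B' *v x) = x" "B' *v (B *v x) = x" for x
    by (simp_all add: matrix_vector_mul_assoc)
  have inj: "inj ((*v) B')" by (metis B'(1) injI)
  show ?thesis
  proof (rule singular_value_ge[OF m])
    show "subspace ((*v) B' ` V)" by (intro linear_subspace_image V matrix_vector_mul_linear)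
    show "m \<le> dim ((*v) B' ` V)"
      using dim_image_eq[OF matrix_vector_mul_linear, of B' V] inj V by (simp add: inj_on_subset)
    fix x assume "x \<in> (*v) B' ` V"
    then have Bx: "B *v x \<in> V" by (auto simp: B')
    have "singular_value m A * singular_value CARD('n) B * norm x \<le> singular_value m A * norm (B *v x)"
      using norm_matrix_vector_ge[of B x] singular_value_nonneg[OF m, of A] by (simp add: mult.assoc mult_left_mono)
    also have "\<dots> \<le> norm ((A ** B) *v x)" using V(3)[OF Bx] by (simp add: matrix_vector_mul_assoc)
    finally show "singular_value m A * singular_value CARD('n) B * norm x \<le> norm ((A ** B) *v x)" .
  qed
qed

text \<open>Here the test space for A is the image under B of a good space for AB. Invertibility
  preserves its dimension, and since B does not lengthen vectors the lower bound on AB passes to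
  A.\<close>

lemma singular_value_mult_contraction_le:
  fixes A B :: "real^'n^'n"
  assumes m: "m \<in> {1..CARD('n)}" and B: "invertible B" and le1: "singular_value 1 B \<le> 1"
  shows "singular_value m (A ** B) \<le> singular_value m A"
proof -
  obtain V where V: "subspace V" "dim V = m" "\<And>x. x \<in> V \<Longrightarrow> singular_value m (A ** B) * norm x \<le> norm ((A ** B) *v x)"
    using singular_value_subspaces[OF m, of "A ** B"] by metis
  have inj: "inj ((*v) B)" by (metis B inj_matrix_vector_mult)
  show ?thesis
  proof (rule singular_value_ge[OF m])
    show "subspace ((*v) B ` V)" by (intro linear_subspace_image V matrix_vector_mul_linear)
    show "m \<le> dim ((*v) B ` V)"
      using dim_image_eq[OF matrix_vector_mul_linear, of B V] inj V by (simp add: inj_on_subset)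
    fix y assume "y \<in> (*v) B ` V"
    then obtain x where x: "x \<in> V" "y = B *v x" by auto
    have "norm y \<le> norm x"
      using norm_matrix_vector_le[of B x] mult_right_mono[OF le1, of "norm x"] x by simp
    then have "singular_value m (A ** B) * norm y \<le> singular_value m (A ** B) * norm x"
      using singular_value_nonneg[OF m] by (intro mult_left_mono)
    also have "\<dots> \<le> norm (A *v y)" using V(3)[OF x(1)] x(2) by (simp add: matrix_vector_mul_assoc)
    finally show "singular_value m (A ** B) * norm y \<le> norm (A *v y)" .
  qed
qed

lemma singular_value_mat_1:
  assumes "m \<in> {1..CARD('n)}"
  shows "singular_value m (mat 1 :: real^'n^'n) = 1"
proof (rule antisym)
  have "singular_value m (mat 1 :: real^'n^'n) \<le> singular_value 1 (mat 1 :: real^'n^'n)"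
    using assms by (intro singular_value_antimono) auto
  also have "\<dots> \<le> 1" by (rule singular_value_1_le) simp
  finally show "singular_value m (mat 1 :: real^'n^'n) \<le> 1" .
  show "1 \<le> singular_value m (mat 1 :: real^'n^'n)"
    using assms by (intro singular_value_ge[where V = UNIV]) auto
qed

text \<open>\<open>w\<close> are the left singular vectors: they span the axes of the ellipsoid \<open>A (ball 0 1)\<close>.\<close>

lemma singular_value_box:
  fixes A :: "real^'n^'n"
  assumes pos: "\<And>i. i \<in> {1..CARD('n)} \<Longrightarrow> 0 < singular_value i A"
  obtains w where "\<And>i j. i \<in> {1..CARD('n)} \<Longrightarrow> j \<in> {1..CARD('n)} \<Longrightarrow> w i \<bullet> w j = (if i = j then 1 else 0)"
    "\<And>i x. i \<in> {1..CARD('n)} \<Longrightarrow> \<bar>(A *v x) \<bullet> w i\<bar> \<le> singular_value i A * norm x"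
proof -
  obtain v where v: "\<And>i j. i \<in> {1..CARD('n)} \<Longrightarrow> j \<in> {1..CARD('n)} \<Longrightarrow> v i \<bullet> v j = (if i = j then 1 else 0)"
    and Av: "\<And>i j. i \<in> {1..CARD('n)} \<Longrightarrow> j \<in> {1..CARD('n)} \<Longrightarrow>
       (A *v v i) \<bullet> (A *v v j) = (if i = j then (singular_value i A)\<^sup>2 else 0)"
    by (rule singular_value_decomposition[of A]) blast
  have d: "DIM(real^'n) = CARD('n)" by simp
  note v' = v[folded d]
  define w where "w i = (A *v v i) /\<^sub>R singular_value i A" for i
  show thesis
  proof (rule that[of w])
    fix i j assume ij: "i \<in> {1..CARD('n)}" "j \<in> {1..CARD('n)}"
    with pos[OF ij(1)] show "w i \<bullet> w j = (if i = j then 1 else 0)"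
      using Av[OF ij] by (cases "i = j") (simp_all add: w_def power2_eq_square field_simps)
  next
    fix i x assume i: "i \<in> {1..CARD('n)}"
    have "x = (\<Sum>j\<in>{1..CARD('n)}. (x \<bullet> v j) *\<^sub>R v j)"
      using orthonormal_expansion[OF v' order_refl, of x] orthonormal_family_span[OF v'] by simp
    then have "A *v x = A *v (\<Sum>j\<in>{1..CARD('n)}. (x \<bullet> v j) *\<^sub>R v j)" by (rule arg_cong)
    then have "(A *v x) \<bullet> w i = (\<Sum>j\<in>{1..CARD('n)}. (x \<bullet> v j) * ((A *v v j) \<bullet> w i))"
      by (simp only: linear_sum[OF matrix_vector_mul_linear] linear_scale[OF matrix_vector_mul_linear]
        inner_sum_left inner_scaleR_left)
    also have "\<dots> = (\<Sum>j\<in>{1..CARD('n)}. if j = i then (x \<bullet> v i) * singular_value i A else 0)"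
      using i pos[OF i] by (intro sum.cong) (auto simp: w_def Av power2_eq_square)
    also have "\<dots> = (x \<bullet> v i) * singular_value i A" using i by simp
    finally have "\<bar>(A *v x) \<bullet> w i\<bar> = \<bar>x \<bullet> v i\<bar> * singular_value i A"
      using pos[OF i] by (simp add: abs_mult)
    also have "\<bar>x \<bullet> v i\<bar> \<le> norm x"
      using Cauchy_Schwarz_ineq2[of x "v i"] v[OF i i] by (simp add: norm_eq_sqrt_inner[of "v i"])
    finally show "\<bar>(A *v x) \<bullet> w i\<bar> \<le> singular_value i A * norm x"
      using pos[OF i] by (simp add: mult_ac)
  qed
qed

section \<open>Mesh cubes\<close>

text \<open>Labels mesh cubes by integer vectors: a cube is a fibre of this map, and the number of
  cubes met by a set is the cardinality of its image.\<close>

definition mesh_index :: "real \<Rightarrow> real^'n \<Rightarrow> int^'n" where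
  "mesh_index r x = (\<chi> i. \<lfloor>x $ i / r\<rfloor>)"

lemma mesh_index_eq_iff:
  assumes "0 < r"
  shows "mesh_index r x = j \<longleftrightarrow> (\<forall>i. of_int (j $ i) * r \<le> x $ i \<and> x $ i < (of_int (j $ i) + 1) * r)"
  using assms by (simp add: mesh_index_def vec_eq_iff floor_eq_iff pos_le_divide_eq pos_divide_less_eq)

lemma mesh_cubes_eq:
  assumes "0 < r"
  shows "mesh_cubes r = range (\<lambda>j. {x. mesh_index r x = j})"
  by (simp add: mesh_cubes_def mesh_index_eq_iff[OF assms])

text \<open>No cube is empty, so different labels give different cubes; the sums over cubes can
  therefore be reindexed by labels.\<close>

lemma mesh_index_surj:
  assumes "0 < r"
  obtains x where "mesh_index r x = j"
proof
  show "mesh_index r (\<chi> i. of_int (j $ i) * r) = j"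
    using assms by (simp add: mesh_index_def vec_eq_iff)
qed

lemma mesh_cube_borel:
  assumes "0 < r"
  shows "{x. mesh_index r x = j} \<in> sets borel"
proof -
  have "{x. mesh_index r x = j} =
      (\<Inter>i. {x. of_int (j $ i) * r \<le> x $ i} \<inter> {x. x $ i < (of_int (j $ i) + 1) * r})"
    using assms by (auto simp: mesh_index_eq_iff)
  also have "\<dots> \<in> sets borel"
    by (intro sets.finite_INT sets.Int borel_closed borel_open open_halfspace_component_lt_cart
        closed_halfspace_component_ge_cart) auto
  finally show ?thesis .
qed

lemma card_int_box:
  fixes a b :: "'n::finite \<Rightarrow> int"
  shows "finite {j::int^'n. \<forall>i. j $ i \<in> {a i..b i}}"
    "card {j::int^'n. \<forall>i. j $ i \<in> {a i..b i}} = (\<Prod>i\<in>UNIV. nat (b i - a i + 1))"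
proof -
  have eq: "{j::int^'n. \<forall>i. j $ i \<in> {a i..b i}} = vec_lambda ` (\<Pi>\<^sub>E i\<in>UNIV. {a i..b i})"
  proof (intro equalityI subsetI)
    fix j assume "j \<in> {j::int^'n. \<forall>i. j $ i \<in> {a i..b i}}"
    then show "j \<in> vec_lambda ` (\<Pi>\<^sub>E i\<in>UNIV. {a i..b i})"
      by (intro image_eqI[of _ _ "vec_nth j"]) (auto simp: PiE_iff)
  qed (auto simp: PiE_iff)
  show "finite {j::int^'n. \<forall>i. j $ i \<in> {a i..b i}}"
    unfolding eq by (intro finite_imageI finite_PiE) auto
  have "inj_on vec_lambda (\<Pi>\<^sub>E i\<in>UNIV. {a i..b i})"
    by (intro inj_onI) (simp add: vec_lambda_inject)
  then show "card {j::int^'n. \<forall>i. j $ i \<in> {a i..b i}} = (\<Prod>i\<in>UNIV. nat (b i - a i + 1))"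
    unfolding eq by (simp add: card_image card_PiE)
qed

text \<open>Dividing the box into cells of side \<open>r\<close> parallel to its axes, each cell has diameter at most
  \<open>d r\<close> and so meets a number of mesh cubes that depends on \<open>d\<close> only.\<close>

lemma card_mesh_index_box:
  fixes w :: "nat \<Rightarrow> real^'n" and K :: "(real^'n) set"
  assumes w: "\<And>i j. i \<in> {1..CARD('n)} \<Longrightarrow> j \<in> {1..CARD('n)} \<Longrightarrow> w i \<bullet> w j = (if i = j then 1 else 0)"
    and r: "0 < r" and \<rho>: "\<And>i. i \<in> {1..CARD('n)} \<Longrightarrow> 0 \<le> \<rho> i"
    and K: "\<And>x i. x \<in> K \<Longrightarrow> i \<in> {1..CARD('n)} \<Longrightarrow> \<bar>(x - p) \<bullet> w i\<bar> \<le> \<rho> i"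
  shows "finite (mesh_index r ` K)"
    "real (card (mesh_index r ` K)) \<le> real (2 * CARD('n) + 1) ^ CARD('n) * (\<Prod>i=1..CARD('n). 2 * \<rho> i / r + 2)"
proof -
  define d where "d = CARD('n)"
  \<comment> \<open>The cell of x in the grid of side r along the axes \<open>w i\<close> with base
    point \<open>p\<close>; \<open>\<Phi>\<close> collects the cells that can meet the box.\<close>
  define \<phi> where "\<phi> x = (\<lambda>i\<in>{1..d}. \<lfloor>(x - p) \<bullet> w i / r\<rfloor>)" for x
  define \<Phi> where "\<Phi> = (\<Pi>\<^sub>E i\<in>{1..d}. {\<lfloor>- \<rho> i / r\<rfloor>..\<lfloor>\<rho> i / r\<rfloor>})"
  define Kg where "Kg g = {x \<in> K. \<phi> x = g}" for g
  have fin: "finite \<Phi>" unfolding \<Phi>_def by (intro finite_PiE) auto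
  have \<phi>: "\<phi> x \<in> \<Phi>" if "x \<in> K" for x
  proof -
    have "- \<rho> i / r \<le> (x - p) \<bullet> w i / r" "(x - p) \<bullet> w i / r \<le> \<rho> i / r" if "i \<in> {1..d}" for i
      using K[OF \<open>x \<in> K\<close>, of i] that r by (auto intro!: divide_right_mono simp: d_def simp del: divide_minus_left)
    then show ?thesis by (auto simp: \<phi>_def \<Phi>_def intro!: floor_mono simp del: divide_minus_left)
  qed
  \<comment> \<open>Two points of one cell differ by at most r along each axis, hence by at most d r
    in norm. Their mesh labels then differ by at most d in each of the d coordinates, which leaves
    (2 d + 1)^d labels.\<close>
  have fiber: "finite (mesh_index r ` Kg g) \<and> card (mesh_index r ` Kg g) \<le> (2 * d + 1) ^ d" for g
  proof (cases "Kg g = {}")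
    case False
    then obtain y where y: "y \<in> Kg g" by blast
    let ?B = "{j::int^'n. \<forall>i. j $ i \<in> {mesh_index r y $ i - int d..mesh_index r y $ i + int d}}"
    have "mesh_index r x \<in> ?B" if x: "x \<in> Kg g" for x
    proof -
      have "\<bar>(x - y) \<bullet> w i\<bar> \<le> r" if i: "i \<in> {1..d}" for i
      proof -
        have "\<phi> x i = \<phi> y i" using x y by (simp add: Kg_def)
        then have "\<lfloor>(x - p) \<bullet> w i / r\<rfloor> = \<lfloor>(y - p) \<bullet> w i / r\<rfloor>" using i by (simp add: \<phi>_def)
        then have "\<bar>(x - p) \<bullet> w i / r - (y - p) \<bullet> w i / r\<bar> \<le> 1" by linarith
        also have "(x - p) \<bullet> w i / r - (y - p) \<bullet> w i / r = (x - y) \<bullet> w i / r"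
          by (simp add: inner_diff_left diff_divide_distrib)
        finally show ?thesis using r by (simp add: abs_divide)
      qed
      moreover have "norm (w i) = 1" if "i \<in> {1..d}" for i
        using w[of i i] that by (simp add: norm_eq_1 d_def)
      moreover have "x - y = (\<Sum>i\<in>{1..d}. ((x - y) \<bullet> w i) *\<^sub>R w i)"
        using orthonormal_expansion[of w "{1..d}" "x - y"] orthonormal_family_span[of w] w by (simp add: d_def)
      then have "norm (x - y) \<le> (\<Sum>i\<in>{1..d}. norm (((x - y) \<bullet> w i) *\<^sub>R w i))"
        by (metis norm_sum)
      ultimately have n: "norm (x - y) \<le> d * r"
        using sum_bounded_above[of "{1..d}" "\<lambda>i. norm (((x - y) \<bullet> w i) *\<^sub>R w i)" r] by fastforce
      have "\<bar>mesh_index r x $ i - mesh_index r y $ i\<bar> \<le> int d" for i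
      proof -
        have "\<bar>x $ i - y $ i\<bar> \<le> d * r" using component_le_norm_cart[of "x - y" i] n by simp
        then have "\<bar>(x $ i - y $ i) / r\<bar> \<le> d" using r by (simp add: abs_divide pos_divide_le_eq)
        then have "x $ i / r \<le> y $ i / r + of_int (int d)" "y $ i / r \<le> x $ i / r + of_int (int d)"
          by (auto simp: diff_divide_distrib)
        from floor_mono[OF this(1)] floor_mono[OF this(2)] show ?thesis
          by (simp only: mesh_index_def vec_lambda_beta floor_add_int[symmetric])
      qed
      then have "mesh_index r y $ i - int d \<le> mesh_index r x $ i \<and> mesh_index r x $ i \<le> mesh_index r y $ i + int d" for i
        by (smt (verit))
      then show ?thesis by simp
    qed
    then have sub: "mesh_index r ` Kg g \<subseteq> ?B" by blast
    have "card ?B = (2 * d + 1) ^ d"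
      by (subst card_int_box(2)) (simp add: d_def nat_add_distrib nat_mult_distrib)
    with card_mono[OF card_int_box(1) sub] finite_subset[OF sub card_int_box(1)] show ?thesis by simp
  qed auto
  have eq: "mesh_index r ` K = (\<Union>g\<in>\<Phi>. mesh_index r ` Kg g)"
    using \<phi> by (auto simp: Kg_def)
  show "finite (mesh_index r ` K)" unfolding eq using fin fiber by blast
  have "card (mesh_index r ` K) \<le> (\<Sum>g\<in>\<Phi>. card (mesh_index r ` Kg g))"
    unfolding eq using fin by (rule card_UN_le)
  also have "\<dots> \<le> card \<Phi> * (2 * d + 1) ^ d" using fiber sum_bounded_above[of \<Phi> "\<lambda>g. card (mesh_index r ` Kg g)" "(2 * d + 1) ^ d"] by simp
  finally have "real (card (mesh_index r ` K)) \<le> real (card \<Phi> * (2 * d + 1) ^ d)"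
    by (rule of_nat_mono)
  also have "\<dots> = real (2 * d + 1) ^ d * real (card \<Phi>)" by simp
  \<comment> \<open>The number of integers from floor(-t) to floor(t) is at most 2 t + 2, since
    floor(-t) may lie almost 1 below -t.\<close>
  also have "real (card \<Phi>) = (\<Prod>i=1..d. real (nat (\<lfloor>\<rho> i / r\<rfloor> - \<lfloor>- \<rho> i / r\<rfloor> + 1)))"
    by (simp add: \<Phi>_def card_PiE)
  also have "\<dots> \<le> (\<Prod>i=1..d. 2 * \<rho> i / r + 2)"
  proof (intro prod_mono conjI)
    fix i assume i: "i \<in> {1..d}"
    have "- \<rho> i / r \<le> \<rho> i / r" using \<rho>[of i] i r by (simp add: d_def)
    then have "\<lfloor>- \<rho> i / r\<rfloor> \<le> \<lfloor>\<rho> i / r\<rfloor>" by (rule floor_mono)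
    moreover have "- \<rho> i / r = - (\<rho> i / r)" "2 * \<rho> i / r = 2 * (\<rho> i / r)" by simp_all
    ultimately show "real (nat (\<lfloor>\<rho> i / r\<rfloor> - \<lfloor>- \<rho> i / r\<rfloor> + 1)) \<le> 2 * \<rho> i / r + 2"
      by linarith
  qed auto
  finally show "real (card (mesh_index r ` K)) \<le>
      real (2 * CARD('n) + 1) ^ CARD('n) * (\<Prod>i=1..CARD('n). 2 * \<rho> i / r + 2)"
    by (simp add: d_def mult_left_mono)
qed

section \<open>Power and entropy sums\<close>

text \<open>The line is the tangent at y = 1 of a concave function; the bound is Young's inequality
  for y^q * 1^(1-q).\<close>

lemma powr_le_tangent:
  fixes y q :: real
  assumes "0 \<le> y" "0 < q" "q \<le> 1"
  shows "y powr q \<le> q * y + (1 - q)"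
  using Youngs_inequality_0[of q "1 - q" y 1] assms by (cases "y = 0") auto

text \<open>The convex case follows by applying the concave one to y^q with exponent 1 / q.\<close>

lemma powr_ge_tangent:
  fixes y q :: real
  assumes "0 \<le> y" "1 \<le> q"
  shows "q * y + (1 - q) \<le> y powr q"
proof -
  have "y = (y powr q) powr (1 / q)" using assms by (simp add: powr_powr)
  also have "\<dots> \<le> 1 / q * y powr q + (1 - 1 / q)" using assms by (intro powr_le_tangent) auto
  finally have "q * y \<le> q * (1 / q * y powr q + (1 - 1 / q))" using assms by (intro mult_left_mono) auto
  then show ?thesis using assms by (simp add: algebra_simps)
qed

text \<open>The power mean inequality, obtained by adding the tangent bounds for the normalised
  terms N x_i / S with S the sum. An upper bound \<open>N\<close> may replace the cardinality
  because 1 - q <= 0; this lets an estimated cube count be inserted directly.\<close>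

lemma sum_powr_ge_powr_sum:
  fixes x :: "'a \<Rightarrow> real"
  assumes fin: "finite I" and x: "\<And>i. i \<in> I \<Longrightarrow> 0 \<le> x i" and q: "1 \<le> q" and N: "real (card I) \<le> N" "0 < N"
  shows "(\<Sum>i\<in>I. x i) powr q \<le> N powr (q - 1) * (\<Sum>i\<in>I. x i powr q)"
proof -
  define S where "S = (\<Sum>i\<in>I. x i)"
  show ?thesis
  proof (cases "S = 0")
    case True
    then show ?thesis by (simp add: S_def sum_nonneg)
  next
    case False
    then have S: "0 < S" using x by (simp add: S_def sum_nonneg order_less_le)
    have "(\<Sum>i\<in>I. q * (N / S * x i)) = q * (N / S) * S"
      by (simp only: S_def sum_distrib_left mult.assoc)
    then have lin: "(\<Sum>i\<in>I. q * (N / S * x i) + (1 - q)) = (1 - q) * card I + q * N"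
      using S by (simp add: sum.distrib)
    have "N \<le> (1 - q) * card I + q * N" using mult_left_mono_neg[OF N(1), of "1 - q"] q by (simp add: algebra_simps)
    also have "\<dots> = (\<Sum>i\<in>I. q * (N / S * x i) + (1 - q))"
      by (rule lin[symmetric])
    also have "\<dots> \<le> (\<Sum>i\<in>I. (N / S * x i) powr q)"
      using x N S q by (intro sum_mono powr_ge_tangent) auto
    also have "\<dots> = N powr q / S powr q * (\<Sum>i\<in>I. x i powr q)"
      using x N S by (simp add: powr_mult powr_divide sum_distrib_left)
    finally have "N * S powr q \<le> N powr q * (\<Sum>i\<in>I. x i powr q)"
      using S by (simp add: pos_le_divide_eq field_simps)
    moreover have "N powr q = N * N powr (q - 1)" using N powr_add[of N 1 "q - 1"] by simp
    ultimately show ?thesis using N(2) by (simp add: S_def)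
  qed
qed

text \<open>The same normalisation with the concave tangent bound; now 1 - q >= 0 and the inequality
  turns around.\<close>

lemma sum_powr_le_powr_sum:
  fixes x :: "'a \<Rightarrow> real"
  assumes fin: "finite I" and x: "\<And>i. i \<in> I \<Longrightarrow> 0 \<le> x i" and q: "0 < q" "q \<le> 1"
    and N: "real (card I) \<le> N" "0 < N"
  shows "(\<Sum>i\<in>I. x i powr q) \<le> N powr (1 - q) * (\<Sum>i\<in>I. x i) powr q"
proof -
  define S where "S = (\<Sum>i\<in>I. x i)"
  show ?thesis
  proof (cases "S = 0")
    case True
    then have "x i = 0" if "i \<in> I" for i using that fin x by (simp add: S_def sum_nonneg_eq_0_iff)
    then show ?thesis by simp
  next
    case False
    then have S: "0 < S" using x by (simp add: S_def sum_nonneg order_less_le)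
    have "(\<Sum>i\<in>I. q * (N / S * x i)) = q * (N / S) * S"
      by (simp only: S_def sum_distrib_left mult.assoc)
    then have lin: "(\<Sum>i\<in>I. q * (N / S * x i) + (1 - q)) = (1 - q) * card I + q * N"
      using S by (simp add: sum.distrib)
    have "N powr q / S powr q * (\<Sum>i\<in>I. x i powr q) = (\<Sum>i\<in>I. (N / S * x i) powr q)"
      using x N S by (simp add: powr_mult powr_divide sum_distrib_left)
    also have "\<dots> \<le> (\<Sum>i\<in>I. q * (N / S * x i) + (1 - q))"
      using x N S q by (intro sum_mono powr_le_tangent) auto
    also have "\<dots> = (1 - q) * card I + q * N" by (rule lin)
    also have "\<dots> \<le> N" using mult_left_mono[OF N(1), of "1 - q"] q by (simp add: algebra_simps)
    finally have "N powr q * (\<Sum>i\<in>I. x i powr q) \<le> N * S powr q"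
      using S by (simp add: pos_divide_le_eq field_simps)
    moreover have "N = N powr q * N powr (1 - q)" using N powr_add[of N q "1 - q"] by simp
    ultimately have "N powr q * (\<Sum>i\<in>I. x i powr q) \<le> N powr q * (N powr (1 - q) * S powr q)"
      by (metis mult.assoc)
    then show ?thesis using N(2) by (simp add: S_def)
  qed
qed

text \<open>Write x^q = x * x^(q-1) and enlarge the second factor by replacing x with the whole
  sum.\<close>

lemma powr_sum_superadditive:
  fixes x :: "'a \<Rightarrow> real"
  assumes fin: "finite I" and x: "\<And>i. i \<in> I \<Longrightarrow> 0 \<le> x i" and q: "1 \<le> q"
  shows "(\<Sum>i\<in>I. x i powr q) \<le> (\<Sum>i\<in>I. x i) powr q"
proof -
  have e: "y powr q = y * y powr (q - 1)" if "0 \<le> y" for y :: real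
    using that powr_add[of y 1 "q - 1"] by (cases "y = 0") auto
  have "(\<Sum>i\<in>I. x i powr q) \<le> (\<Sum>i\<in>I. x i * (\<Sum>i\<in>I. x i) powr (q - 1))"
    using x q fin by (intro sum_mono) (auto simp: e intro!: mult_left_mono powr_mono2 member_le_sum)
  also have "\<dots> = (\<Sum>i\<in>I. x i) powr q" using x by (simp add: e sum_nonneg sum_distrib_right)
  finally show ?thesis .
qed

text \<open>Same factorisation, but the exponent q - 1 is nonpositive, so enlarging the base
  decreases the power and zero terms need a case of their own.\<close>

lemma powr_sum_subadditive:
  fixes x :: "'a \<Rightarrow> real"
  assumes fin: "finite I" and x: "\<And>i. i \<in> I \<Longrightarrow> 0 \<le> x i" and q: "0 < q" "q \<le> 1"
  shows "(\<Sum>i\<in>I. x i) powr q \<le> (\<Sum>i\<in>I. x i powr q)"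
proof -
  have e: "y powr q = y * y powr (q - 1)" if "0 \<le> y" for y :: real
    using that q powr_add[of y 1 "q - 1"] by (cases "y = 0") auto
  have "(\<Sum>i\<in>I. x i) powr q = (\<Sum>i\<in>I. x i * (\<Sum>i\<in>I. x i) powr (q - 1))"
    using x by (simp add: e sum_nonneg sum_distrib_right)
  also have "\<dots> \<le> (\<Sum>i\<in>I. x i powr q)"
  proof (intro sum_mono)
    fix i assume i: "i \<in> I"
    show "x i * (\<Sum>i\<in>I. x i) powr (q - 1) \<le> x i powr q"
    proof (cases "x i = 0")
      case False
      then have "0 < x i" using x[OF i] by simp
      moreover have "x i \<le> (\<Sum>i\<in>I. x i)" using fin x i by (intro member_le_sum) auto
      ultimately have "(\<Sum>i\<in>I. x i) powr (q - 1) \<le> x i powr (q - 1)" using q by (intro powr_mono2') auto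
      then show ?thesis using x[OF i] by (simp add: e mult_left_mono)
    qed simp
  qed
  finally show ?thesis .
qed

text \<open>The entropy of a mass spread over at most \<open>N\<close> cells is greatest for equal
  shares. Termwise this is ln t <= t - 1 with t the ratio of the equal share S / N to x_i.\<close>

lemma sum_xlnx_ge:
  fixes x :: "'a \<Rightarrow> real"
  assumes fin: "finite I" and x: "\<And>i. i \<in> I \<Longrightarrow> 0 \<le> x i" and N: "real (card I) \<le> N" "0 < N"
  shows "(\<Sum>i\<in>I. x i) * ln ((\<Sum>i\<in>I. x i) / N) \<le> (\<Sum>i\<in>I. x i * ln (x i))"
proof -
  define S where "S = (\<Sum>i\<in>I. x i)"
  show ?thesis
  proof (cases "S = 0")
    case True
    then have "x i = 0" if "i \<in> I" for i using that fin x by (simp add: S_def sum_nonneg_eq_0_iff)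
    then show ?thesis by simp
  next
    case False
    then have S: "0 < S" using x by (simp add: S_def sum_nonneg order_less_le)
    have "x i * ln (S / N) - x i * ln (x i) \<le> S / N - x i" if i: "i \<in> I" for i
    proof (cases "x i = 0")
      case False
      then have xi: "0 < x i" using x[OF i] by simp
      have "ln (S / N) - ln (x i) = ln (S / N / x i)" using xi S N by (simp add: ln_div ln_mult)
      also have "\<dots> \<le> S / N / x i - 1" using xi S N by (intro ln_le_minus_one) auto
      finally have "x i * (ln (S / N) - ln (x i)) \<le> x i * (S / N / x i - 1)" using xi by (intro mult_left_mono) auto
      also have "\<dots> = S / N - x i" using xi by (simp add: field_simps)
      finally show ?thesis by (simp add: algebra_simps)
    qed (use S N in simp)
    then have "(\<Sum>i\<in>I. x i * ln (S / N) - x i * ln (x i)) \<le> (\<Sum>i\<in>I. S / N - x i)" by (rule sum_mono)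
    also have "\<dots> = card I * (S / N) - S" by (simp add: sum_subtractf S_def)
    also have "\<dots> = (card I - N) * (S / N)" using N by (simp add: field_simps)
    also have "\<dots> \<le> 0" using N S by (intro mult_nonpos_nonneg) auto
    finally show ?thesis by (simp add: sum_subtractf sum_distrib_right[symmetric] S_def)
  qed
qed

lemma sum_xlnx_le:
  fixes x :: "'a \<Rightarrow> real"
  assumes fin: "finite I" and x: "\<And>i. i \<in> I \<Longrightarrow> 0 \<le> x i"
  shows "(\<Sum>i\<in>I. x i * ln (x i)) \<le> (\<Sum>i\<in>I. x i) * ln (\<Sum>i\<in>I. x i)"
  unfolding sum_distrib_right
proof (rule sum_mono)
  fix i assume i: "i \<in> I"
  show "x i * ln (x i) \<le> x i * ln (\<Sum>i\<in>I. x i)"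
  proof (cases "x i = 0")
    case False
    then have xi: "0 < x i" using x[OF i] by simp
    moreover have "x i \<le> (\<Sum>i\<in>I. x i)" using fin x i by (intro member_le_sum) auto
    ultimately show ?thesis by (intro mult_left_mono) (auto intro!: ln_mono)
  qed simp
qed

text \<open>The intended reading: \<open>U\<close> indexes the pieces of a partition,
  \<open>G\<close> the mesh cubes, \<open>p u j\<close> is the mass of piece \<open>u\<close> in
  cube \<open>j\<close>, and \<open>Gu u\<close> are the cubes met by piece
  \<open>u\<close>.\<close>

context
  fixes U :: "'u set" and G :: "'g set" and p :: "'u \<Rightarrow> 'g \<Rightarrow> real" and Gu :: "'u \<Rightarrow> 'g set"
    and \<psi> :: "'u \<Rightarrow> real" and D :: real
  assumes fin: "finite U" "finite G" and p: "\<And>u j. 0 \<le> p u j"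
    and Gu: "\<And>u. u \<in> U \<Longrightarrow> Gu u \<subseteq> G" "\<And>u j. u \<in> U \<Longrightarrow> j \<notin> Gu u \<Longrightarrow> p u j = 0"
    and card: "\<And>u. u \<in> U \<Longrightarrow> real (card (Gu u)) \<le> D * \<psi> u"
    and D: "0 < D" and \<psi>: "\<And>u. u \<in> U \<Longrightarrow> 0 < \<psi> u"
begin

private lemma sum_Gu: "u \<in> U \<Longrightarrow> h 0 = (0::real) \<Longrightarrow> (\<Sum>j\<in>Gu u. h (p u j)) = (\<Sum>j\<in>G. h (p u j))"
  using fin Gu by (intro sum.mono_neutral_left) auto

text \<open>Within one piece, the power mean inequality over at most D \<psi> cubes costs (D
  \<psi>)^(q-1). The weight \<psi>^(1-q) in the cut sum cancels the part depending on the piece;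
  superadditivity then merges the pieces inside each cube.\<close>

lemma double_sum_powr_ge:
  assumes q: "1 \<le> q"
  shows "(\<Sum>u\<in>U. \<psi> u powr (1 - q) * (\<Sum>j\<in>G. p u j) powr q)
    \<le> D powr (q - 1) * (\<Sum>j\<in>G. (\<Sum>u\<in>U. p u j) powr q)"
proof -
  have "(\<Sum>u\<in>U. \<psi> u powr (1 - q) * (\<Sum>j\<in>G. p u j) powr q)
      \<le> (\<Sum>u\<in>U. D powr (q - 1) * (\<Sum>j\<in>G. p u j powr q))"
  proof (rule sum_mono)
    fix u assume u: "u \<in> U"
    have "(\<Sum>j\<in>G. p u j) powr q = (\<Sum>j\<in>Gu u. p u j) powr q" using sum_Gu[OF u, of "\<lambda>x. x"] by simp
    also have "\<dots> \<le> (D * \<psi> u) powr (q - 1) * (\<Sum>j\<in>Gu u. p u j powr q)"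
      using fin Gu(1)[OF u] p q card[OF u] D \<psi>[OF u]
      by (intro sum_powr_ge_powr_sum) (auto intro: finite_subset)
    also have "\<dots> = D powr (q - 1) * \<psi> u powr (q - 1) * (\<Sum>j\<in>G. p u j powr q)"
      using D \<psi>[OF u] sum_Gu[OF u, of "\<lambda>x. x powr q"] by (simp add: powr_mult)
    finally have "\<psi> u powr (1 - q) * (\<Sum>j\<in>G. p u j) powr q
        \<le> \<psi> u powr (1 - q) * (D powr (q - 1) * \<psi> u powr (q - 1) * (\<Sum>j\<in>G. p u j powr q))"
      by (intro mult_left_mono) auto
    also have "\<dots> = (\<psi> u powr (1 - q) * \<psi> u powr (q - 1)) * (D powr (q - 1) * (\<Sum>j\<in>G. p u j powr q))"
      by simp
    also have "\<psi> u powr (1 - q) * \<psi> u powr (q - 1) = 1" using \<psi>[OF u] by (simp flip: powr_add)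
    finally show "\<psi> u powr (1 - q) * (\<Sum>j\<in>G. p u j) powr q \<le> D powr (q - 1) * (\<Sum>j\<in>G. p u j powr q)"
      by simp
  qed
  also have "\<dots> = D powr (q - 1) * (\<Sum>j\<in>G. \<Sum>u\<in>U. p u j powr q)"
    by (simp add: sum_distrib_left sum.swap[of _ G U])
  also have "\<dots> \<le> D powr (q - 1) * (\<Sum>j\<in>G. (\<Sum>u\<in>U. p u j) powr q)"
    using fin p q by (intro mult_left_mono sum_mono powr_sum_superadditive) auto
  finally show ?thesis .
qed

text \<open>For q <= 1 the two steps occur in the opposite order: split each cube into pieces by
  subadditivity, then apply the power mean inequality inside each piece.\<close>

lemma double_sum_powr_le:
  assumes q: "0 < q" "q \<le> 1"
  shows "(\<Sum>j\<in>G. (\<Sum>u\<in>U. p u j) powr q)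
    \<le> D powr (1 - q) * (\<Sum>u\<in>U. \<psi> u powr (1 - q) * (\<Sum>j\<in>G. p u j) powr q)"
proof -
  have "(\<Sum>j\<in>G. (\<Sum>u\<in>U. p u j) powr q) \<le> (\<Sum>j\<in>G. \<Sum>u\<in>U. p u j powr q)"
    using fin p q by (intro sum_mono powr_sum_subadditive) auto
  also have "\<dots> = (\<Sum>u\<in>U. \<Sum>j\<in>G. p u j powr q)" by (rule sum.swap)
  also have "\<dots> \<le> (\<Sum>u\<in>U. D powr (1 - q) * (\<psi> u powr (1 - q) * (\<Sum>j\<in>G. p u j) powr q))"
  proof (rule sum_mono)
    fix u assume u: "u \<in> U"
    have "(\<Sum>j\<in>G. p u j powr q) = (\<Sum>j\<in>Gu u. p u j powr q)" using sum_Gu[OF u, of "\<lambda>x. x powr q"] by simp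
    also have "\<dots> \<le> (D * \<psi> u) powr (1 - q) * (\<Sum>j\<in>Gu u. p u j) powr q"
      using fin Gu(1)[OF u] p q card[OF u] D \<psi>[OF u]
      by (intro sum_powr_le_powr_sum) (auto intro: finite_subset)
    also have "\<dots> = D powr (1 - q) * (\<psi> u powr (1 - q) * (\<Sum>j\<in>G. p u j) powr q)"
      using D \<psi>[OF u] sum_Gu[OF u, of "\<lambda>x. x"] by (simp add: powr_mult)
    finally show "(\<Sum>j\<in>G. p u j powr q) \<le> D powr (1 - q) * (\<psi> u powr (1 - q) * (\<Sum>j\<in>G. p u j) powr q)" .
  qed
  finally show ?thesis by (simp add: sum_distrib_left)
qed

text \<open>The logarithm turns the factor D into the additive term ln D, weighted by the total
  mass.\<close>

lemma double_sum_xlnx_ge: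
  "(\<Sum>u\<in>U. (\<Sum>j\<in>G. p u j) * ln (inverse (\<psi> u) * (\<Sum>j\<in>G. p u j)))
    \<le> (\<Sum>j\<in>G. (\<Sum>u\<in>U. p u j) * ln (\<Sum>u\<in>U. p u j)) + (\<Sum>u\<in>U. \<Sum>j\<in>G. p u j) * ln D"
proof -
  have "(\<Sum>u\<in>U. (\<Sum>j\<in>G. p u j) * ln (inverse (\<psi> u) * (\<Sum>j\<in>G. p u j)))
      \<le> (\<Sum>u\<in>U. (\<Sum>j\<in>G. p u j * ln (p u j)) + (\<Sum>j\<in>G. p u j) * ln D)"
  proof (rule sum_mono)
    fix u assume u: "u \<in> U"
    define m where "m = (\<Sum>j\<in>G. p u j)"
    have "m \<ge> 0" using p by (simp add: m_def sum_nonneg)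
    have "m * ln (m / (D * \<psi> u)) \<le> (\<Sum>j\<in>Gu u. p u j * ln (p u j))"
      using sum_xlnx_ge[of "Gu u" "p u" "D * \<psi> u"] sum_Gu[OF u, of "\<lambda>x. x"] fin Gu(1)[OF u] p card[OF u] D \<psi>[OF u]
      by (auto simp: m_def intro: finite_subset)
    also have "\<dots> = (\<Sum>j\<in>G. p u j * ln (p u j))" using sum_Gu[OF u, of "\<lambda>x. x * ln x"] by simp
    finally have "m * ln (m / (D * \<psi> u)) \<le> (\<Sum>j\<in>G. p u j * ln (p u j))" .
    moreover have "m * ln (inverse (\<psi> u) * m) = m * ln (m / (D * \<psi> u)) + m * ln D"
      using \<open>m \<ge> 0\<close> D \<psi>[OF u]
      by (cases "m = 0") (simp_all add: ln_mult ln_div ln_inverse algebra_simps)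
    ultimately show "(\<Sum>j\<in>G. p u j) * ln (inverse (\<psi> u) * (\<Sum>j\<in>G. p u j))
        \<le> (\<Sum>j\<in>G. p u j * ln (p u j)) + (\<Sum>j\<in>G. p u j) * ln D"
      by (simp add: m_def)
  qed
  also have "\<dots> = (\<Sum>j\<in>G. \<Sum>u\<in>U. p u j * ln (p u j)) + (\<Sum>u\<in>U. \<Sum>j\<in>G. p u j) * ln D"
    by (simp add: sum.distrib sum_distrib_right sum.swap[of _ G U])
  also have "(\<Sum>j\<in>G. \<Sum>u\<in>U. p u j * ln (p u j)) \<le> (\<Sum>j\<in>G. (\<Sum>u\<in>U. p u j) * ln (\<Sum>u\<in>U. p u j))"
    using fin p by (intro sum_mono sum_xlnx_le) auto
  finally show ?thesis by simp
qed

end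

section \<open>Mesh sums of a partitioned measure\<close>

lemma measure_eq_sum_fibers:
  assumes M: "finite_measure M" and G: "finite G" "g ` A \<subseteq> G"
    and meas: "\<And>j. j \<in> G \<Longrightarrow> {w \<in> A. g w = j} \<in> sets M"
  shows "measure M A = (\<Sum>j\<in>G. measure M {w \<in> A. g w = j})"
proof -
  have "A = (\<Union>j\<in>G. {w \<in> A. g w = j})" using G by auto
  also have "measure M \<dots> = (\<Sum>j\<in>G. measure M {w \<in> A. g w = j})"
    using G meas by (intro finite_measure.finite_measure_finite_Union[OF M]) (auto simp: disjoint_family_on_def)
  finally show ?thesis .
qed

text \<open>All cubes outside \<open>G\<close> are null, so the \<open>ereal\<close> sum over all
  cubes collapses to a finite real one. Positivity of the power sum keeps \<open>ln_ereal\<close>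
  away from its infinite values.\<close>

lemma mesh_quotient_eq_sum:
  fixes f :: "'b \<Rightarrow> real^'n"
  assumes M: "finite_measure M" "0 < measure M (space M)" and f: "f \<in> borel_measurable M"
    and r: "0 < r" "r < 1" and q: "0 < q"
    and G: "finite G" "mesh_index r ` f ` space M \<subseteq> G"
  defines "\<nu> \<equiv> \<lambda>j. measure M {w \<in> space M. mesh_index r (f w) = j}"
  shows "mesh_quotient q (distr M borel f) r =
    ereal (if q = 1 then (\<Sum>j\<in>G. \<nu> j * ln (\<nu> j)) / ln r else ln (\<Sum>j\<in>G. \<nu> j powr q) / ((q - 1) * ln r))"
    "0 < (\<Sum>j\<in>G. \<nu> j powr q)"
proof -
  define cube where "cube j = {x :: real^'n. mesh_index r x = j}" for j
  have meas: "{w \<in> space M. mesh_index r (f w) = j} \<in> sets M" for j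
  proof -
    have "{w \<in> space M. mesh_index r (f w) = j} = f -` cube j \<inter> space M" by (auto simp: cube_def)
    also have "\<dots> \<in> sets M" unfolding cube_def by (rule measurable_sets[OF f mesh_cube_borel[OF r(1)]])
    finally show ?thesis .
  qed
  have \<nu>: "measure (distr M borel f) (cube j) = \<nu> j" for j
    using measure_distr[OF f] mesh_cube_borel[OF r(1), of j]
    by (simp add: \<nu>_def cube_def vimage_def Int_def conj_commute)
  have "inj cube"
  proof (rule injI)
    fix j k assume "cube j = cube k"
    moreover obtain x where "mesh_index r x = j" using mesh_index_surj[OF r(1)] .
    ultimately show "j = k" by (auto simp: cube_def)
  qed
  have sum: "(\<Sum>\<^sub>\<infinity>Q\<in>mesh_cubes r. ereal (h (measure (distr M borel f) Q))) = ereal (\<Sum>j\<in>G. h (\<nu> j))"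
    if "h 0 = 0" for h :: "real \<Rightarrow> real"
  proof -
    have "(\<Sum>\<^sub>\<infinity>Q\<in>mesh_cubes r. ereal (h (measure (distr M borel f) Q))) = (\<Sum>\<^sub>\<infinity>j\<in>UNIV. ereal (h (\<nu> j)))"
      unfolding mesh_cubes_eq[OF r(1)] cube_def[symmetric]
      by (subst infsum_reindex[OF \<open>inj cube\<close>]) (simp add: o_def \<nu>)
    also have "\<dots> = (\<Sum>\<^sub>\<infinity>j\<in>G. ereal (h (\<nu> j)))"
    proof (rule infsum_cong_neutral)
      fix j assume "j \<in> UNIV - G"
      then have "{w \<in> space M. mesh_index r (f w) = j} = {}" using G by auto
      then have "\<nu> j = 0" by (simp only: \<nu>_def measure_empty)
      then show "ereal (h (\<nu> j)) = 0" using that by simp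
    qed auto
    also have "\<dots> = ereal (\<Sum>j\<in>G. h (\<nu> j))" using G by simp
    finally show ?thesis .
  qed
  have "measure M (space M) = (\<Sum>j\<in>G. \<nu> j)"
    unfolding \<nu>_def using G meas by (intro measure_eq_sum_fibers[OF M(1)]) auto
  with M(2) have "\<exists>j\<in>G. \<nu> j \<noteq> 0" by (metis less_irrefl sum.neutral)
  then obtain j where j: "j \<in> G" "0 < \<nu> j" by (metis \<nu>_def measure_nonneg order_le_less)
  then have "0 < \<nu> j powr q" by simp
  also have "\<dots> \<le> (\<Sum>j\<in>G. \<nu> j powr q)" using G j by (intro member_le_sum) auto
  finally show pos: "0 < (\<Sum>j\<in>G. \<nu> j powr q)" .
  have "ln r < 0" using r by simp
  then show "mesh_quotient q (distr M borel f) r =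
    ereal (if q = 1 then (\<Sum>j\<in>G. \<nu> j * ln (\<nu> j)) / ln r else ln (\<Sum>j\<in>G. \<nu> j powr q) / ((q - 1) * ln r))"
    using sum[of "\<lambda>x. x * ln x"] sum[of "\<lambda>x. x powr q"] pos by (auto simp: mesh_quotient_def ln_ereal_def)
qed

text \<open>The estimate behind both bounds of the theorem: the pieces \<open>C u\<close> are the cylinders of the cut
  set with weights \<open>\<psi>\<^sup>s\<close>, or the whole space with weight 1 and \<open>s = d\<close>.\<close>

lemma mesh_quotient_le_partition:
  fixes f :: "'b \<Rightarrow> real^'n" and C :: "'u \<Rightarrow> 'b set"
  assumes M: "finite_measure M" "0 < measure M (space M)" and f: "f \<in> borel_measurable M"
    and q: "0 < q" "q = 1 \<Longrightarrow> measure M (space M) \<le> 1" and r: "0 < r" "r < 1" and s: "0 \<le> s"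
    and U: "finite U" "\<And>u. u \<in> U \<Longrightarrow> C u \<in> sets M" "disjoint_family_on C U" "(\<Union>u\<in>U. C u) = space M"
    and \<psi>: "\<And>u. u \<in> U \<Longrightarrow> 0 < \<psi> u" and B: "0 < B"
    and card: "\<And>u. u \<in> U \<Longrightarrow> finite (mesh_index r ` f ` C u)"
      "\<And>u. u \<in> U \<Longrightarrow> real (card (mesh_index r ` f ` C u)) \<le> B * \<psi> u * r powr (- s)"
    and F: "F = (if q = 1 then (\<Sum>u\<in>U. measure M (C u) * ln (inverse (\<psi> u) * measure M (C u)))
      else (\<Sum>u\<in>U. \<psi> u powr (1 - q) * measure M (C u) powr q))"
    and c: "if q < 1 then F \<le> c else c \<le> F" "q \<noteq> 1 \<Longrightarrow> 0 < c"
  shows "mesh_quotient q (distr M borel f) r \<le>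
    ereal (s + (if q = 1 then measure M (space M) * ln B - c else ln B - ln c / (q - 1)) / (- ln r))"
proof -
  define Gu where "Gu u = mesh_index r ` f ` C u" for u
  define G where "G = (\<Union>u\<in>U. Gu u)"
  define p where "p u j = measure M {w \<in> C u. mesh_index r (f w) = j}" for u j
  define \<nu> where "\<nu> j = measure M {w \<in> space M. mesh_index r (f w) = j}" for j
  define D where "D = B * r powr (- s)"
  define L where "L = - ln r"
  have L: "0 < L" using r by (simp add: L_def)
  have G: "finite G" "mesh_index r ` f ` space M \<subseteq> G"
    using U card by (auto simp: G_def Gu_def U(4)[symmetric])
  have img: "mesh_index r (f w) \<in> G" if "w \<in> space M" for w using G(2) that by blast
  have sub: "C u \<subseteq> space M" if "u \<in> U" for u using U that by blast
  have meas: "{w \<in> C u. mesh_index r (f w) = j} \<in> sets M" if "u \<in> U" for u j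
  proof -
    have "{w \<in> C u. mesh_index r (f w) = j} = C u \<inter> (f -` {x. mesh_index r x = j} \<inter> space M)"
      using sub[OF that] by auto
    also have "\<dots> \<in> sets M"
      using measurable_sets[OF f mesh_cube_borel[OF r(1)]] U(2)[OF that] by blast
    finally show ?thesis .
  qed
  have m: "measure M (C u) = (\<Sum>j\<in>G. p u j)" if "u \<in> U" for u
    unfolding p_def using that G(1) meas subsetD[OF sub[OF that]]
    by (intro measure_eq_sum_fibers[OF M(1)]) (auto intro: img)
  have \<nu>: "\<nu> j = (\<Sum>u\<in>U. p u j)" for j
  proof -
    have "{w \<in> space M. mesh_index r (f w) = j} = (\<Union>u\<in>U. {w \<in> C u. mesh_index r (f w) = j})"
      using U(4) by auto
    moreover have "disjoint_family_on (\<lambda>u. {w \<in> C u. mesh_index r (f w) = j}) U"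
      using U(3) unfolding disjoint_family_on_def by blast
    ultimately show ?thesis unfolding \<nu>_def p_def using U(1) meas
      by (auto intro!: finite_measure.finite_measure_finite_Union[OF M(1)])
  qed
  have total: "measure M (space M) = (\<Sum>u\<in>U. \<Sum>j\<in>G. p u j)"
    using finite_measure.finite_measure_finite_Union[OF M(1) U(1) _ U(3)] U m by (auto simp: image_subset_iff)
  have D: "0 < D" using B r by (simp add: D_def)
  \<comment> \<open>The exponent s of the final bound comes from here: ln D / L = s + ln B /
    L.\<close>
  have lnD: "ln D = ln B + s * L" using B r by (simp add: D_def L_def ln_mult ln_powr)
  have Gu: "\<And>u. u \<in> U \<Longrightarrow> Gu u \<subseteq> G" "\<And>u j. u \<in> U \<Longrightarrow> j \<notin> Gu u \<Longrightarrow> p u j = 0"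
    "\<And>u. u \<in> U \<Longrightarrow> real (card (Gu u)) \<le> D * \<psi> u"
  proof -
    fix u j assume "u \<in> U" "j \<notin> Gu u"
    then have "{w \<in> C u. mesh_index r (f w) = j} = {}" by (auto simp: Gu_def)
    then show "p u j = 0" by (simp only: p_def measure_empty)
  next
    fix u assume "u \<in> U"
    then show "real (card (Gu u)) \<le> D * \<psi> u" using card(2) by (simp add: Gu_def D_def mult_ac)
  qed (auto simp: G_def)
  have p0: "0 \<le> p u j" for u j by (simp add: p_def)
  note bounds = double_sum_powr_ge[where p = p and \<psi> = \<psi>, OF U(1) G(1) p0 Gu D \<psi>, folded \<nu>]
    double_sum_powr_le[where p = p and \<psi> = \<psi>, OF U(1) G(1) p0 Gu D \<psi>, folded \<nu>]
    double_sum_xlnx_ge[where p = p and \<psi> = \<psi>, OF U(1) G(1) p0 Gu D \<psi>, folded \<nu>, folded total]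
  define Z where "Z = (\<Sum>j\<in>G. \<nu> j powr q)"
  have Z: "0 < Z" and mq: "mesh_quotient q (distr M borel f) r =
      ereal (if q = 1 then (\<Sum>j\<in>G. \<nu> j * ln (\<nu> j)) / (- L) else ln Z / ((q - 1) * (- L)))"
    using mesh_quotient_eq_sum[OF M f r q(1) G] unfolding \<nu>_def Z_def L_def by simp_all
  consider "q < 1" | "q = 1" | "1 < q" by linarith
  then show ?thesis
  proof cases
    case 1
    then have c0: "0 < c" using c by simp
    have "F = (\<Sum>u\<in>U. \<psi> u powr (1 - q) * (\<Sum>j\<in>G. p u j) powr q)" using F 1 m by simp
    \<comment> \<open>For q < 1 the denominator (q - 1) ln r is positive, so an upper bound on the
      mesh sum is needed.\<close>
    then have "Z \<le> D powr (1 - q) * F" using bounds(2) q 1 by (simp add: Z_def)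
    also have "\<dots> \<le> D powr (1 - q) * c" using c 1 by (intro mult_left_mono) auto
    finally have "ln Z \<le> ln (D powr (1 - q) * c)" using Z by simp
    also have "\<dots> = (1 - q) * (ln B + s * L) + ln c" using D c0 by (simp add: ln_mult ln_powr lnD)
    finally have "ln Z / ((1 - q) * L) \<le> ((1 - q) * (ln B + s * L) + ln c) / ((1 - q) * L)"
      using 1 L by (intro divide_right_mono) auto
    also have "\<dots> = s + (ln B - ln c / (q - 1)) / L"
    proof -
      have "ln c / (q - 1) = - (ln c / (1 - q))" using 1 by (simp add: field_simps)
      then show ?thesis using 1 L by (simp add: add_divide_distrib)
    qed
    finally show ?thesis using 1 by (simp add: mq L_def[symmetric] minus_mult_commute[symmetric] algebra_simps)
  next
    case 2
    have "F = (\<Sum>u\<in>U. (\<Sum>j\<in>G. p u j) * ln (inverse (\<psi> u) * (\<Sum>j\<in>G. p u j)))" using F 2 m by simp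
    then have "c \<le> (\<Sum>j\<in>G. \<nu> j * ln (\<nu> j)) + measure M (space M) * (ln B + s * L)"
      using bounds(3) c 2 by (simp add: lnD)
    then have "- (\<Sum>j\<in>G. \<nu> j * ln (\<nu> j)) / L \<le> (measure M (space M) * ln B - c + measure M (space M) * s * L) / L"
      using L by (intro divide_right_mono) (auto simp: algebra_simps)
    also have "\<dots> = measure M (space M) * s + (measure M (space M) * ln B - c) / L"
      using L by (simp add: add_divide_distrib)
    \<comment> \<open>Mass at most 1 is used to replace the factor in front of s by 1.\<close>
    also have "\<dots> \<le> s + (measure M (space M) * ln B - c) / L"
      using q(2)[OF 2] s mult_right_mono[of "measure M (space M)" 1 s] by simp
    finally show ?thesis unfolding mq using 2 by (simp add: L_def[symmetric])
  next
    case 3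
    then have c0: "0 < c" using c by simp
    have "F = (\<Sum>u\<in>U. \<psi> u powr (1 - q) * (\<Sum>j\<in>G. p u j) powr q)" using F 3 m by simp
    \<comment> \<open>For q > 1 the denominator is negative, so a lower bound on the mesh sum bounds
      the quotient from above.\<close>
    then have "c \<le> D powr (q - 1) * Z" using bounds(1)[of q] c 3 by (simp add: Z_def)
    then have "ln c \<le> ln (D powr (q - 1) * Z)" using c0 by simp
    also have "\<dots> = (q - 1) * (ln B + s * L) + ln Z" using D Z by (simp add: ln_mult ln_powr lnD)
    finally have "(- ln Z) / ((q - 1) * L) \<le> ((q - 1) * (ln B + s * L) - ln c) / ((q - 1) * L)"
      using 3 L by (intro divide_right_mono) auto
    also have "\<dots> = s + (ln B - ln c / (q - 1)) / L"
      using 3 L by (simp add: add_divide_distrib diff_divide_distrib)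
    finally show ?thesis using 3 by (simp add: mq L_def[symmetric])
  qed
qed

text \<open>The error K / (- ln r) vanishes as r tends to 0. The bound on \<open>h\<close> is tied
  to a predicate so that one estimate at fixed r serves both limits: \<open>P\<close> for all small
  r, or merely at arbitrarily small r.\<close>

lemma Limsup_Liminf_at_right_le_of_ln_error:
  fixes h :: "real \<Rightarrow> ereal"
  assumes h: "\<And>r. 0 < r \<Longrightarrow> r < 1 \<Longrightarrow> P r \<Longrightarrow> h r \<le> ereal (s + K / (- ln r))"
  shows "eventually P (at_right 0) \<Longrightarrow> Limsup (at_right 0) h \<le> ereal s"
    and "frequently P (at_right 0) \<Longrightarrow> Liminf (at_right 0) h \<le> ereal s"
proof -
  let ?g = "\<lambda>r. ereal (s + K / (- ln r))"
  have "((\<lambda>r. s + K / (- ln r)) \<longlongrightarrow> s + 0) (at_right 0)"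
    by (intro tendsto_add tendsto_const tendsto_divide_0[OF tendsto_const]
        filterlim_at_top_imp_at_infinity filterlim_uminus_at_top[THEN iffD1, of "\<lambda>r. - (- ln r)"])
      (simp add: filterlim_uminus_at_top[symmetric] ln_at_0 flip: filterlim_uminus_at_bot)
  then have lim: "(?g \<longlongrightarrow> ereal s) (at_right 0)" by simp
  have ev: "eventually (\<lambda>r::real. 0 < r \<and> r < 1) (at_right 0)"
    using eventually_at_right_real[of 0 1] by simp
  show "Limsup (at_right 0) h \<le> ereal s" if P: "eventually P (at_right 0)"
  proof -
    have "Limsup (at_right 0) h \<le> Limsup (at_right 0) ?g"
      by (rule Limsup_mono) (use eventually_conj[OF ev P] in \<open>eventually_elim, use h in blast\<close>)
    also have "\<dots> = ereal s" using lim by (intro lim_imp_Limsup) auto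
    finally show ?thesis .
  qed
  show "Liminf (at_right 0) h \<le> ereal s" if P: "frequently P (at_right 0)"
  proof (rule ccontr)
    assume "\<not> Liminf (at_right 0) h \<le> ereal s"
    then obtain z where z: "ereal s < z" "z < Liminf (at_right 0) h" using dense by (metis not_le)
    have "eventually (\<lambda>r. \<not> P r) (at_right 0)"
      using less_LiminfD[OF z(2)] order_tendstoD(2)[OF lim z(1)] ev
      by eventually_elim (use h in force)
    with P show False by (simp add: frequently_def)
  qed
qed

section \<open>Words and cut sets\<close>

lemma foldr_matrix_mult:
  "foldr (\<lambda>i A. M i ** A) xs B = foldr (\<lambda>i A. M i ** A) xs (mat 1) ** (B :: real^'n^'n)"
  by (induction xs) (simp_all add: matrix_mul_assoc)

lemma word_matrix_Nil [simp]: "word_matrix T [] = mat 1"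
  by (simp add: word_matrix_def)

lemma word_matrix_snoc: "word_matrix T (u @ [j]) = word_matrix T u ** T (Suc (length u)) j"
proof -
  have "word_matrix T (u @ [j])
      = foldr (\<lambda>i A. T (Suc i) ((u @ [j]) ! i) ** A) [0..<length u] (T (Suc (length u)) j)"
    by (simp add: word_matrix_def)
  also have "\<dots> = foldr (\<lambda>i A. T (Suc i) (u ! i) ** A) [0..<length u] (T (Suc (length u)) j)"
    by (rule foldr_cong) (auto simp: nth_append)
  also have "\<dots> = word_matrix T u ** T (Suc (length u)) j"
    unfolding word_matrix_def by (rule foldr_matrix_mult)
  finally show ?thesis .
qed

lemma foldr_affine:
  fixes M :: "nat \<Rightarrow> real^'n^'n"
  shows "\<exists>p. \<forall>x. foldr (\<lambda>i f. (\<lambda>x. M i *v x + b i) \<circ> f) xs id x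
    = foldr (\<lambda>i A. M i ** A) xs (mat 1) *v x + p"
proof (induction xs)
  case Nil
  show ?case by (rule exI[of _ 0]) simp
next
  case (Cons i xs)
  then obtain p where "\<forall>x. foldr (\<lambda>i f. (\<lambda>x. M i *v x + b i) \<circ> f) xs id x
    = foldr (\<lambda>i A. M i ** A) xs (mat 1) *v x + p" by blast
  then have "foldr (\<lambda>i f. (\<lambda>x. M i *v x + b i) \<circ> f) (i # xs) id x
    = foldr (\<lambda>i A. M i ** A) (i # xs) (mat 1) *v x + (M i *v p + b i)" for x
    by (simp only: foldr.simps o_apply matrix_vector_right_distrib matrix_vector_mul_assoc[symmetric] add.assoc)
  then show ?case by blast
qed

lemma affine_comp_eq:
  obtains p where "\<And>x. affine_comp T \<omega> u x = word_matrix T u *v x + p"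
  using that foldr_affine[of "\<lambda>i. T (Suc i) (u ! i)" "\<lambda>i. \<omega> (take (Suc i) u)" "[0..<length u]"]
  unfolding affine_comp_def word_matrix_def by blast

section \<open>Cylinders and measurability of the projection\<close>

lemma finite_words_Nil [simp]: "[] \<in> finite_words n"
  by (auto simp: finite_words_def words_def)

lemma finite_words_snoc:
  "u @ [j] \<in> finite_words n \<longleftrightarrow> u \<in> finite_words n \<and> j \<in> {1..n (Suc (length u))}"
  by (auto simp: finite_words_def words_def nth_append less_Suc_eq)

lemma length_word_prefix [simp]: "length (word_prefix w k) = k"
  by (simp add: word_prefix_def)

lemma word_prefix_Suc: "word_prefix w (Suc k) = word_prefix w k @ [w k]"
  by (simp add: word_prefix_def)

lemma word_prefix_finite_words: "w \<in> infinite_words n \<Longrightarrow> word_prefix w k \<in> finite_words n"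
  using word_prefix_words by (auto simp: finite_words_def)

lemma cylinder_Nil: "cylinder n [] = infinite_words n"
  by (auto simp: cylinder_def word_prefix_def)

text \<open>A cylinder restricts finitely many coordinates, each in a discrete space, so it is the
  trace of an open set of the product topology.\<close>

lemma cylinder_sets:
  "cylinder n u \<in> sets (restrict_space borel (infinite_words n))"
proof -
  have "word_prefix w (length u) = u \<longleftrightarrow> (\<forall>i<length u. w i = u ! i)" for w
    unfolding word_prefix_def list_eq_iff_nth_eq by simp
  then have eq: "cylinder n u = infinite_words n \<inter> (\<Inter>i<length u. (\<lambda>w. w i) -` {u ! i})"
    unfolding cylinder_def by blast
  have "open ((\<lambda>w::nat \<Rightarrow> nat. w i) -` {u ! i})" for i
    by (rule open_vimage[OF open_discrete continuous_on_product_coordinates])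
  then have op: "open (\<Inter>i<length u. (\<lambda>w::nat \<Rightarrow> nat. w i) -` {u ! i})" by (intro open_INT) auto
  show ?thesis
    unfolding sets_restrict_space eq by (rule imageI) (rule borel_open[OF op])
qed

lemma measurable_word_prefix:
  assumes "sets \<mu> = sets (restrict_space borel (infinite_words n))"
  shows "(\<lambda>w. word_prefix w k) \<in> measurable \<mu> (count_space UNIV)"
proof -
  have sp: "space \<mu> = infinite_words n"
    using sets_eq_imp_space_eq[OF assms] by (simp add: space_restrict_space)
  have "(\<lambda>w. word_prefix w k) -` {u} \<inter> space \<mu> = (if length u = k then cylinder n u else {})" for u
    by (auto simp: cylinder_def sp)
  then show ?thesis
    by (simp add: measurable_count_space_eq2_countable assms cylinder_sets)
qed

lemma word_proj_mem:
  assumes "nonautonomous_structure n T J \<omega> JJ" "compact J" "J \<noteq> {}" "w \<in> infinite_words n"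
  shows "word_proj JJ w \<in> JJ (word_prefix w k)"
  using theI'[OF word_proj_ex1[OF assms]] by (auto simp: word_proj_def)

text \<open>The projection is a pointwise limit of maps that depend on a finite prefix only: the
  images of one fixed point of \<open>J\<close> under the maps of the prefixes. The shrinking
  diameters give convergence.\<close>

lemma measurable_word_proj:
  fixes JJ :: "nat list \<Rightarrow> (real^'n) set"
  assumes S: "nonautonomous_structure n T J \<omega> JJ" and J: "compact J" "J \<noteq> {}"
    and \<mu>: "sets \<mu> = sets (restrict_space borel (infinite_words n))"
  shows "word_proj JJ \<in> borel_measurable \<mu>"
proof -
  have sp: "space \<mu> = infinite_words n"
    using sets_eq_imp_space_eq[OF \<mu>] by (simp add: space_restrict_space)
  have im: "JJ u = affine_comp T \<omega> u ` J" "JJ u \<subseteq> J" "closed (JJ u)" if "u \<in> finite_words n" for u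
    using S that unfolding nonautonomous_structure_def by blast+
  obtain x0 where x0: "x0 \<in> J" using J by blast
  show ?thesis
  proof (rule borel_measurable_LIMSEQ_metric)
    fix k
    show "(\<lambda>w. affine_comp T \<omega> (word_prefix w k) x0) \<in> borel_measurable \<mu>"
      using measurable_compose[OF measurable_word_prefix[OF \<mu>, of k], of "\<lambda>u. affine_comp T \<omega> u x0" borel]
      by simp
  next
    fix w assume "w \<in> space \<mu>"
    then have w: "w \<in> infinite_words n" by (simp add: sp)
    have dist_le: "dist (affine_comp T \<omega> (word_prefix w k) x0) (word_proj JJ w) \<le> Max ((\<lambda>u. diameter (JJ u)) ` words n k)" for k
    proof -
      note fw = word_prefix_finite_words[OF w, of k]
      have "bounded (JJ (word_prefix w k))"
        using im(2)[OF fw] J(1) bounded_subset compact_imp_bounded by blast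
      then have "dist (affine_comp T \<omega> (word_prefix w k) x0) (word_proj JJ w) \<le> diameter (JJ (word_prefix w k))"
        using x0 im(1)[OF fw] word_proj_mem[OF S J w, of k] by (intro diameter_bounded_bound) auto
      also have "\<dots> \<le> Max ((\<lambda>u. diameter (JJ u)) ` words n k)"
        using word_prefix_words[OF w] finite_words_level by (intro Max_ge) auto
      finally show ?thesis .
    qed
    have "(\<lambda>k. Max ((\<lambda>u. diameter (JJ u)) ` words n k)) \<longlonglongrightarrow> 0"
      using S by (simp add: nonautonomous_structure_def)
    then have "(\<lambda>k. dist (affine_comp T \<omega> (word_prefix w k) x0) (word_proj JJ w)) \<longlonglongrightarrow> 0"
      by (rule Lim_null_comparison[rotated]) (simp add: dist_le)
    then show "(\<lambda>k. affine_comp T \<omega> (word_prefix w k) x0) \<longlonglongrightarrow> word_proj JJ w"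
      by (rule tendsto_dist_iff[THEN iffD2])
  qed
qed

lemma nat_ceiling_mem:
  fixes s :: real
  assumes "0 < s" "s \<le> real N"
  shows "nat \<lceil>s\<rceil> \<in> {1..N}"
proof -
  have "0 < \<lceil>s\<rceil>" "\<lceil>s\<rceil> \<le> int N" using assms by (simp_all add: ceiling_le_iff)
  then show ?thesis unfolding atLeastAtMost_iff by linarith
qed

section \<open>Singular values along words, and cut sets\<close>

locale matrix_family =
  fixes n :: "nat \<Rightarrow> nat" and T :: "nat \<Rightarrow> nat \<Rightarrow> real^'n^'n" and a b :: real
  assumes a: "0 < a" and b: "b < 1"
    and inv: "\<And>k i. 1 \<le> k \<Longrightarrow> i \<in> {1..n k} \<Longrightarrow> invertible (T k i)"
    and ge: "\<And>k i. 1 \<le> k \<Longrightarrow> i \<in> {1..n k} \<Longrightarrow> a \<le> singular_value CARD('n) (T k i)"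
    and le: "\<And>k i. 1 \<le> k \<Longrightarrow> i \<in> {1..n k} \<Longrightarrow> singular_value 1 (T k i) \<le> b"
    and n1: "\<And>k. 1 \<le> k \<Longrightarrow> 1 \<le> n k"
begin

lemma a_le_b: "a \<le> b"
  using ge[of 1 1] le[of 1 1] n1[of 1] singular_value_antimono[of 1 "CARD('n)" "T 1 1"] by simp

lemma singular_value_snoc:
  assumes m: "m \<in> {1..CARD('n)}" and u: "u @ [j] \<in> finite_words n"
  shows "a * singular_value m (word_matrix T u) \<le> singular_value m (word_matrix T (u @ [j]))"
    "singular_value m (word_matrix T (u @ [j])) \<le> singular_value m (word_matrix T u)"
proof -
  let ?A = "word_matrix T u" and ?B = "T (Suc (length u)) j"
  have j: "j \<in> {1..n (Suc (length u))}" using u by (simp add: finite_words_snoc)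
  have "a * singular_value m ?A \<le> singular_value m ?A * singular_value CARD('n) ?B"
    using mult_right_mono[OF ge[OF _ j] singular_value_nonneg[OF m, of ?A]] by (simp add: mult.commute)
  also have "\<dots> \<le> singular_value m (?A ** ?B)"
    using m inv[OF _ j] by (intro singular_value_mult_ge) auto
  finally show "a * singular_value m ?A \<le> singular_value m (word_matrix T (u @ [j]))"
    by (simp add: word_matrix_snoc)
  show "singular_value m (word_matrix T (u @ [j])) \<le> singular_value m ?A"
    unfolding word_matrix_snoc using m inv[OF _ j] le[OF _ j] b
    by (intro singular_value_mult_contraction_le) auto
qed

lemma singular_value_word_pos:
  assumes m: "m \<in> {1..CARD('n)}"
  shows "u \<in> finite_words n \<Longrightarrow> 0 < singular_value m (word_matrix T u)"
proof (induction u rule: rev_induct)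
  case Nil
  then show ?case using m by (simp add: singular_value_mat_1)
next
  case (snoc j u)
  then have "0 < a * singular_value m (word_matrix T u)" using a by (simp add: finite_words_snoc)
  with singular_value_snoc(1)[OF m snoc.prems] show ?case by linarith
qed

lemma singular_value_word_le:
  "u \<in> finite_words n \<Longrightarrow> singular_value 1 (word_matrix T u) \<le> b ^ length u"
proof (induction u rule: rev_induct)
  case Nil
  then show ?case by (simp add: singular_value_mat_1)
next
  case (snoc j u)
  then have j: "j \<in> {1..n (Suc (length u))}" and u: "u \<in> finite_words n" by (simp_all add: finite_words_snoc)
  have "singular_value 1 (word_matrix T (u @ [j])) \<le> singular_value 1 (word_matrix T u) * singular_value 1 (T (Suc (length u)) j)"
    unfolding word_matrix_snoc by (rule singular_value_mult_1_le)
  also have "\<dots> \<le> b ^ length u * b"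
    using snoc.IH[OF u] le[OF _ j] a a_le_b by (intro mult_mono singular_value_nonneg) auto
  finally show ?case by (simp add: mult.commute)
qed

text \<open>The cut set depends on s only through the index \<open>m\<close>, which is made the
  parameter here.\<close>

definition cut :: "nat \<Rightarrow> real \<Rightarrow> nat list set" where
  "cut m r = {u \<in> finite_words n. u \<noteq> [] \<and> singular_value m (word_matrix T u) \<le> r \<and>
    r < singular_value m (word_matrix T (butlast u))}"

lemma cut_set_eq_cut: "cut_set n T s r = cut (min (nat \<lceil>s\<rceil>) CARD('n)) r"
  by (simp add: cut_set_def cut_def Let_def)

lemma singular_value_word_le':
  assumes "m \<in> {1..CARD('n)}" "u \<in> finite_words n"
  shows "singular_value m (word_matrix T u) \<le> b ^ length u"
  using singular_value_antimono[of 1 m "word_matrix T u"] singular_value_word_le[OF assms(2)] assms(1) by simp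

text \<open>The parent of a cut word still has its m-th singular value above r, while that value is
  at most b^length; so the length of the parent is bounded.\<close>

lemma finite_cut:
  assumes m: "m \<in> {1..CARD('n)}" and r: "0 < r"
  shows "finite (cut m r)"
proof -
  obtain N where N: "b ^ N < r" using real_arch_pow_inv[OF r b] by blast
  have "cut m r \<subseteq> (\<Union>k\<le>N. words n k)"
  proof
    fix u assume u: "u \<in> cut m r"
    then have "u \<noteq> []" by (simp add: cut_def)
    then obtain v j where v: "u = v @ [j]" using rev_exhaust by blast
    then have vf: "v \<in> finite_words n" using u by (simp add: cut_def finite_words_snoc)
    have "r < singular_value m (word_matrix T v)" using u v by (simp add: cut_def)
    then have "b ^ N < b ^ length v" using N singular_value_word_le'[OF m vf] by linarith
    then have "length v < N" using a a_le_b b power_decreasing[of N "length v" b] by force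
    then show "u \<in> (\<Union>k\<le>N. words n k)" using u v by (auto simp: cut_def finite_words_def words_def)
  qed
  then show ?thesis using finite_words_level by (auto intro: finite_subset)
qed

text \<open>Along an infinite word the m-th singular value of the prefixes starts at 1 > r, never
  increases, and eventually falls to r or below. It crosses r at exactly one level, and the prefix
  of that level is the cut word.\<close>

lemma cut_partition:
  assumes m: "m \<in> {1..CARD('n)}" and r: "0 < r" "r < 1"
  shows "disjoint_family_on (cylinder n) (cut m r)" "(\<Union>u\<in>cut m r. cylinder n u) = infinite_words n"
proof -
  define \<alpha> where "\<alpha> w k = singular_value m (word_matrix T (word_prefix w k))" for w k
  have dec: "\<alpha> w l \<le> \<alpha> w k" if "w \<in> infinite_words n" "k \<le> l" for w k l
    using \<open>k \<le> l\<close>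
  proof (induction rule: dec_induct)
    case (step l)
    have "\<alpha> w (Suc l) \<le> \<alpha> w l"
      using singular_value_snoc(2)[OF m, of "word_prefix w l" "w l"]
        word_prefix_finite_words[OF that(1), of "Suc l"] by (simp add: \<alpha>_def word_prefix_Suc)
    with step show ?case by simp
  qed simp
  have cut: "word_prefix w k \<in> cut m r \<longleftrightarrow> (\<exists>l. k = Suc l \<and> \<alpha> w k \<le> r \<and> r < \<alpha> w l)"
    if "w \<in> infinite_words n" for w k
    using word_prefix_finite_words[OF that, of k]
    by (cases k) (auto simp: cut_def \<alpha>_def word_prefix_Suc, simp add: word_prefix_def)
  show "disjoint_family_on (cylinder n) (cut m r)"
  proof (unfold disjoint_family_on_def, intro ballI impI, rule ccontr)
    fix u v assume uv: "u \<in> cut m r" "v \<in> cut m r" "u \<noteq> v" and "cylinder n u \<inter> cylinder n v \<noteq> {}"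
    then obtain w where w: "w \<in> infinite_words n" "word_prefix w (length u) = u" "word_prefix w (length v) = v"
      by (auto simp: cylinder_def)
    obtain k where k: "length u = Suc k" "\<alpha> w (length u) \<le> r" "r < \<alpha> w k"
      using cut[OF w(1), of "length u"] uv(1) w(2) by auto
    obtain l where l: "length v = Suc l" "\<alpha> w (length v) \<le> r" "r < \<alpha> w l"
      using cut[OF w(1), of "length v"] uv(2) w(3) by auto
    have "\<not> Suc k \<le> l" "\<not> Suc l \<le> k"
      using dec[OF w(1), of "Suc k" l] dec[OF w(1), of "Suc l" k] k l by auto
    then have "length u = length v" using k(1) l(1) by simp
    with w uv(3) show False by metis
  qed
  show "(\<Union>u\<in>cut m r. cylinder n u) = infinite_words n"
  proof (intro equalityI subsetI)
    fix w assume w: "w \<in> infinite_words n"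
    obtain N where N: "b ^ N < r" using real_arch_pow_inv[OF r(1) b] by blast
    then have "\<alpha> w N \<le> r"
      using singular_value_word_le'[OF m word_prefix_finite_words[OF w, of N]] by (simp add: \<alpha>_def)
    moreover have "\<not> \<alpha> w 0 \<le> r" using r m by (simp add: \<alpha>_def word_prefix_def singular_value_mat_1)
    ultimately obtain k where "\<alpha> w (Suc k) \<le> r" "\<not> \<alpha> w k \<le> r"
      using ex_least_nat_less[of "\<lambda>k. \<alpha> w k \<le> r" N] by auto
    then have "word_prefix w (Suc k) \<in> cut m r" using cut[OF w] by auto
    moreover have "w \<in> cylinder n (word_prefix w (Suc k))" using w by (simp add: cylinder_def)
    ultimately show "w \<in> (\<Union>u\<in>cut m r. cylinder n u)" by blast
  qed (auto simp: cylinder_def)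
qed

text \<open>A projected cylinder lies in \<open>JJ u\<close>, an affine image of \<open>J\<close>,
  and so in a box around the translation part with half-sides \<open>R\<close> times the singular
  values.\<close>

lemma card_mesh_index_cylinder:
  assumes S: "nonautonomous_structure n T J \<omega> JJ" and J: "compact J" "J \<noteq> {}"
    and R: "\<And>x. x \<in> J \<Longrightarrow> norm x \<le> R" and u: "u \<in> finite_words n" and r: "0 < r"
  shows "finite (mesh_index r ` word_proj JJ ` cylinder n u)"
    "real (card (mesh_index r ` word_proj JJ ` cylinder n u)) \<le> real (2 * CARD('n) + 1) ^ CARD('n) *
      (\<Prod>i=1..CARD('n). 2 * (singular_value i (word_matrix T u) * R) / r + 2)"
proof -
  let ?A = "word_matrix T u"
  obtain p where p: "\<And>x. affine_comp T \<omega> u x = ?A *v x + p"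
    using affine_comp_eq[of T \<omega> u] by blast
  have pos: "\<And>i. i \<in> {1..CARD('n)} \<Longrightarrow> 0 < singular_value i ?A"
    using singular_value_word_pos[OF _ u] .
  obtain w where w: "\<And>i j. i \<in> {1..CARD('n)} \<Longrightarrow> j \<in> {1..CARD('n)} \<Longrightarrow> w i \<bullet> w j = (if i = j then 1 else 0)"
    and Aw: "\<And>i x. i \<in> {1..CARD('n)} \<Longrightarrow> \<bar>(?A *v x) \<bullet> w i\<bar> \<le> singular_value i ?A * norm x"
    using singular_value_box[OF pos] by metis
  have R0: "0 \<le> R" using R J(2) norm_ge_zero order_trans by blast
  have K: "\<bar>(y - p) \<bullet> w i\<bar> \<le> singular_value i ?A * R"
    if y: "y \<in> word_proj JJ ` cylinder n u" and i: "i \<in> {1..CARD('n)}" for y i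
  proof -
    have "word_proj JJ w \<in> JJ u" if "w \<in> cylinder n u" for w
      using that word_proj_mem[OF S J, of w "length u"] by (simp add: cylinder_def)
    then have "y \<in> JJ u" using y by blast
    moreover have "JJ u = affine_comp T \<omega> u ` J"
      using S u unfolding nonautonomous_structure_def by blast
    ultimately obtain x where x: "x \<in> J" "y = ?A *v x + p" using p by auto
    have "\<bar>(y - p) \<bullet> w i\<bar> \<le> singular_value i ?A * norm x" using Aw[OF i, of x] x by simp
    also have "\<dots> \<le> singular_value i ?A * R" using R[OF x(1)] pos[OF i] by simp
    finally show ?thesis .
  qed
  have \<rho>: "\<And>i. i \<in> {1..CARD('n)} \<Longrightarrow> 0 \<le> singular_value i ?A * R"
    using pos R0 by (simp add: less_imp_le)
  show "finite (mesh_index r ` word_proj JJ ` cylinder n u)"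
    "real (card (mesh_index r ` word_proj JJ ` cylinder n u)) \<le> real (2 * CARD('n) + 1) ^ CARD('n) *
      (\<Prod>i=1..CARD('n). 2 * (singular_value i ?A * R) / r + 2)"
    using card_mesh_index_box[OF w r \<rho> K] by simp_all
qed

lemma sv_fun_pos:
  fixes s :: real
  assumes s: "0 < s" "s \<le> CARD('n)" and u: "u \<in> finite_words n"
  shows "0 < sv_fun s (word_matrix T u)"
proof -
  define m where "m = nat \<lceil>s\<rceil>"
  have m: "m \<in> {1..CARD('n)}" unfolding m_def by (rule nat_ceiling_mem[OF s])
  have "0 < (\<Prod>i=1..m - 1. singular_value i (word_matrix T u))"
    using m by (intro prod_pos singular_value_word_pos u) auto
  with singular_value_word_pos[OF m u] s show ?thesis by (simp add: sv_fun_def m_def Let_def)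
qed

text \<open>Relative to r, the axes before the m-th are long and those from the m-th on are short.
  The long ones contribute \<alpha>_i / r, the short ones a constant, and r^(-(m-1)) is rewritten as
  r^t r^(-s) with r^t replaced by a multiple of \<alpha>_m^t.\<close>

lemma box_count_le_sv_fun:
  fixes s :: real
  assumes s: "0 < s" "s \<le> CARD('n)" and r: "0 < r" and R: "0 \<le> R" and u: "u \<in> cut_set n T s r"
  shows "(\<Prod>i=1..CARD('n). 2 * (singular_value i (word_matrix T u) * R) / r + 2)
    \<le> ((2 * R + 2 / a) ^ CARD('n) / a) * sv_fun s (word_matrix T u) * r powr (- s)"
proof -
  define m where "m = nat \<lceil>s\<rceil>"
  define \<alpha> where "\<alpha> i = singular_value i (word_matrix T u)" for i
  \<comment> \<open>On short axes \<alpha>_i <= r gives 2 R + 2. On long axes \<alpha>_i >= a r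
    allows the summand 2 to be absorbed as (2 / a) (\<alpha>_i / r). Since a < 1, this one constant
    covers both.\<close>
  define E where "E = 2 * R + 2 / a"
  define t where "t = s - real m + 1"
  have m: "m \<in> {1..CARD('n)}" unfolding m_def by (rule nat_ceiling_mem[OF s])
  have t: "0 < t" "t \<le> 1" using s unfolding t_def m_def by linarith+
  have uc: "u \<in> cut m r" using u m unfolding cut_set_eq_cut m_def[symmetric] by (simp add: min_absorb1)
  then have uf: "u \<in> finite_words n" by (simp add: cut_def)
  have "u \<noteq> []" using uc by (simp add: cut_def)
  then obtain v j where v: "u = v @ [j]" using rev_exhaust by blast
  have pos: "0 < \<alpha> i" if "i \<in> {1..CARD('n)}" for i using singular_value_word_pos[OF that uf] by (simp add: \<alpha>_def)
  have up: "\<alpha> m \<le> r" using uc by (simp add: cut_def \<alpha>_def)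
  have "a * r < a * singular_value m (word_matrix T v)" using uc v a by (simp add: cut_def)
  also have "\<dots> \<le> \<alpha> m" using singular_value_snoc(1)[OF m uf[unfolded v]] by (simp add: \<alpha>_def v)
  finally have low: "a * r \<le> \<alpha> m" by simp
  have a1: "a < 1" using a_le_b b by simp
  have E: "0 < E" using R a by (simp add: E_def add_nonneg_pos)
  have small: "2 * (\<alpha> i * R) / r + 2 \<le> E" if i: "i \<in> {m..CARD('n)}" for i
  proof -
    have "\<alpha> i \<le> r" using singular_value_antimono[of m i "word_matrix T u"] i m up by (simp add: \<alpha>_def)
    then have "\<alpha> i * R / r \<le> R" using r mult_right_mono[OF \<open>\<alpha> i \<le> r\<close> R] by (simp add: pos_divide_le_eq mult.commute)
    moreover have "2 \<le> 2 / a" using a a1 by (simp add: pos_le_divide_eq)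
    ultimately show ?thesis by (simp add: E_def)
  qed
  have large: "2 * (\<alpha> i * R) / r + 2 \<le> E * (\<alpha> i / r)" if i: "i \<in> {1..m-1}" for i
  proof -
    have "\<alpha> m \<le> \<alpha> i" using singular_value_antimono[of i m "word_matrix T u"] i m by (auto simp: \<alpha>_def)
    with low have "a * r \<le> \<alpha> i" by linarith
    then have "2 \<le> 2 / a * (\<alpha> i / r)" using a r by (simp add: field_simps)
    then show ?thesis by (simp add: E_def algebra_simps)
  qed
  have nonneg: "0 \<le> 2 * (\<alpha> i * R) / r + 2" if "i \<in> {1..CARD('n)}" for i
    using pos[OF that] R r by (simp add: add_nonneg_nonneg)
  have split: "{1..CARD('n)} = {1..m-1} \<union> {m..CARD('n)}" using m by auto
  have "(\<Prod>i=1..CARD('n). 2 * (\<alpha> i * R) / r + 2)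
      = (\<Prod>i=1..m-1. 2 * (\<alpha> i * R) / r + 2) * (\<Prod>i=m..CARD('n). 2 * (\<alpha> i * R) / r + 2)"
    unfolding split using m by (intro prod.union_disjoint) auto
  also have "\<dots> \<le> (\<Prod>i=1..m-1. E * (\<alpha> i / r)) * (\<Prod>i=m..CARD('n). E)"
  proof (intro mult_mono prod_mono conjI prod_nonneg)
    fix i assume "i \<in> {1..m-1}"
    then show "0 \<le> E * (\<alpha> i / r)" using E r pos[of i] m by (auto simp: less_imp_le)
  qed (use small large nonneg m in auto)
  also have "\<dots> = E ^ (m - 1 + card {m..CARD('n)}) * ((\<Prod>i=1..m-1. \<alpha> i) / r ^ (m - 1))"
    by (simp add: prod.distrib prod_dividef power_add)
  also have "m - 1 + card {m..CARD('n)} = CARD('n)" using m by auto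
  also have "E ^ CARD('n) * ((\<Prod>i=1..m-1. \<alpha> i) / r ^ (m - 1))
      \<le> E ^ CARD('n) * ((\<Prod>i=1..m-1. \<alpha> i) * \<alpha> m powr t / a * r powr (- s))"
  proof (intro mult_left_mono)
    \<comment> \<open>Since 0 < t <= 1 and a < 1, a <= a^t; hence a r^t <= (a r)^t <= \<alpha>_m^t,
      the source of the extra factor 1 / a in the statement.\<close>
    have "(a * r) powr t \<le> \<alpha> m powr t" using low a r t by (intro powr_mono2) auto
    moreover have "a powr 1 \<le> a powr t" using a a1 t by (intro powr_mono') auto
    then have "a * r powr t \<le> (a * r) powr t" using a r by (simp add: powr_mult mult_right_mono)
    ultimately have "r powr t \<le> \<alpha> m powr t / a" using a by (simp add: pos_le_divide_eq mult.commute)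
    then have "r powr t * r powr (- s) \<le> \<alpha> m powr t / a * r powr (- s)" by (intro mult_right_mono) auto
    moreover have "r powr t * r powr (- s) = 1 / r ^ (m - 1)"
    proof -
      have "t + (- s) = - real (m - 1)" using m by (auto simp: t_def of_nat_diff)
      then have "r powr t * r powr (- s) = r powr - real (m - 1)" by (simp only: powr_add[symmetric])
      also have "\<dots> = 1 / r ^ (m - 1)" by (simp only: powr_minus powr_realpow[OF r] inverse_eq_divide)
      finally show ?thesis .
    qed
    ultimately have "1 / r ^ (m - 1) \<le> \<alpha> m powr t / a * r powr (- s)" by simp
    then have "(\<Prod>i=1..m-1. \<alpha> i) * (1 / r ^ (m - 1)) \<le> (\<Prod>i=1..m-1. \<alpha> i) * (\<alpha> m powr t / a * r powr (- s))"
      using m by (intro mult_left_mono prod_nonneg) (auto intro!: less_imp_le[OF pos])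
    then show "(\<Prod>i=1..m-1. \<alpha> i) / r ^ (m - 1) \<le> (\<Prod>i=1..m-1. \<alpha> i) * \<alpha> m powr t / a * r powr (- s)"
      by (simp add: mult.assoc)
  qed (use E in simp)
  also have "(\<Prod>i=1..m-1. \<alpha> i) * \<alpha> m powr t = sv_fun s (word_matrix T u)"
    using s by (simp add: sv_fun_def Let_def \<alpha>_def t_def m_def)
  finally show ?thesis by (simp add: \<alpha>_def E_def mult_ac)
qed

end

section \<open>Comparison with the critical values\<close>

text \<open>If the supremum were below \<open>D\<close>, some s strictly between them would fail
  \<open>Q\<close>. It is positive because 0 was inserted, and at most d because \<open>D\<close>
  is; so the estimate is required only for s <= d.\<close>

lemma le_Sup_crit:
  assumes "\<And>s. 0 < s \<Longrightarrow> s \<le> real d \<Longrightarrow> \<not> Q s \<Longrightarrow> D \<le> ereal s" "D \<le> ereal (real d)"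
  shows "D \<le> Sup (insert 0 (ereal ` {s. 0 < s \<and> Q s}))"
proof (rule ccontr)
  let ?S = "Sup (insert 0 (ereal ` {s. 0 < s \<and> Q s}))"
  assume "\<not> D \<le> ?S"
  then have "?S < D" by (simp only: not_le)
  then obtain s where s: "?S < ereal s" "ereal s < D" using ereal_dense2 by blast
  have "0 \<le> ?S" by (intro Sup_upper) auto
  then have "0 < ereal s" using s(1) by (rule order_le_less_trans)
  then have s0: "0 < s" by simp
  have "\<not> Q s"
  proof
    assume "Q s"
    then have "ereal s \<le> ?S" using s0 by (intro Sup_upper) auto
    with s(1) show False by (simp only: not_le[symmetric])
  qed
  moreover have "s \<le> real d" using order_less_le_trans[OF s(2) assms(2)] by simp
  ultimately have "D \<le> ereal s" by (intro assms(1) s0)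
  with s(2) show False by simp
qed

text \<open>Members s > d of the set are covered by the bound of \<open>D\<close> by d.\<close>

lemma le_Inf_crit:
  assumes "\<And>s. 0 < s \<Longrightarrow> s \<le> real d \<Longrightarrow> Q s \<Longrightarrow> D \<le> ereal s" "D \<le> ereal (real d)"
  shows "D \<le> Inf (ereal ` {s. 0 < s \<and> Q s})"
proof (rule INF_greatest)
  fix s assume "s \<in> {s. 0 < s \<and> Q s}"
  then show "D \<le> ereal s"
    using assms order_trans[OF assms(2), of "ereal s"] by (cases "s \<le> real d") auto
qed

text \<open>Positivity of the bound is demanded because ln c enters the error term.\<close>

lemma ereal_less_PInf_bound:
  assumes "x < (\<infinity>::ereal)"
  obtains c :: real where "0 < c" "x < ereal c"
proof -
  obtain c where "x < ereal c" using assms less_PInf_Ex_of_nat by fastforce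
  moreover have "ereal c \<le> ereal (max c 1)" by simp
  ultimately have "x < ereal (max c 1)" by (rule order_less_le_trans)
  then show thesis using that[of "max c 1"] by simp
qed

section \<open>Dimension bounds for a fixed structure and measure\<close>

context matrix_family
begin

context
  fixes J :: "(real^'n) set" and \<omega> :: "nat list \<Rightarrow> real^'n" and JJ :: "nat list \<Rightarrow> (real^'n) set"
    and \<mu> :: "(nat \<Rightarrow> nat) measure" and q :: real
  assumes J: "compact J" "J \<noteq> {}" and S: "nonautonomous_structure n T J \<omega> JJ"
    and \<mu>: "sets \<mu> = sets (restrict_space borel (infinite_words n))"
    and fin: "finite_measure \<mu>" and pos: "0 < measure \<mu> (space \<mu>)"
    and q: "0 < q" "q = 1 \<Longrightarrow> measure \<mu> (space \<mu>) \<le> 1"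
begin

lemma space_eq: "space \<mu> = infinite_words n"
  using sets_eq_imp_space_eq[OF \<mu>] by (simp add: space_restrict_space)

lemma mesh_quotient_le_dimension:
  obtains K where "\<And>r. 0 < r \<Longrightarrow> r < 1 \<Longrightarrow>
    mesh_quotient q (image_measure JJ \<mu>) r \<le> ereal (real CARD('n) + K / (- ln r))"
proof -
  define d where "d = CARD('n)"
  obtain R where R: "0 < R" "\<And>x. x \<in> J \<Longrightarrow> norm x \<le> R"
    using compact_imp_bounded[OF J(1)] by (auto simp: bounded_pos)
  \<comment> \<open>All singular values of the identity are 1, and r < 1 gives 2 R / r + 2 <= (2 R +
    2) / r for each of the d factors.\<close>
  define B where "B = real (2 * d + 1) ^ d * (2 * R + 2) ^ d"
  have B: "0 < B" using R by (simp add: B_def)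
  \<comment> \<open>With a single piece of weight 1 the sum F is this constant at every scale, so c
    = F satisfies the required bound in either direction.\<close>
  define c where "c = (if q = 1 then measure \<mu> (space \<mu>) * ln (measure \<mu> (space \<mu>))
    else measure \<mu> (space \<mu>) powr q)"
  have "mesh_quotient q (distr \<mu> borel (word_proj JJ)) r \<le> ereal (real d +
      (if q = 1 then measure \<mu> (space \<mu>) * ln B - c else ln B - ln c / (q - 1)) / (- ln r))"
    if r: "0 < r" "r < 1" for r
  proof (rule mesh_quotient_le_partition[where U = "{[]}" and C = "cylinder n" and \<psi> = "\<lambda>_. 1" and F = c])
    have "real (card (mesh_index r ` word_proj JJ ` cylinder n [])) \<le> real (2 * d + 1) ^ d *
        (\<Prod>i=1..d. 2 * (singular_value i (word_matrix T []) * R) / r + 2)"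
      using card_mesh_index_cylinder(2)[OF S J R(2), of "[]" r] r by (simp add: d_def)
    also have "(\<Prod>i=1..d. 2 * (singular_value i (word_matrix T []) * R) / r + 2) \<le> (\<Prod>i=1..d. (2 * R + 2) / r)"
      using r R by (intro prod_mono) (auto simp: d_def singular_value_mat_1 field_simps)
    also have "(\<Prod>i=1..d. (2 * R + 2) / r) = (2 * R + 2) ^ d * r powr (- real d)"
      using r by (simp add: power_divide powr_minus powr_realpow divide_inverse power_mult_distrib power_inverse)
    finally show "real (card (mesh_index r ` word_proj JJ ` cylinder n u)) \<le> B * 1 * r powr (- real d)"
      if "u \<in> {[]}" for u using that by (simp add: B_def mult.assoc mult_left_mono)
    show "finite (mesh_index r ` word_proj JJ ` cylinder n u)" if "u \<in> {[]}" for u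
      using card_mesh_index_cylinder(1)[OF S J R(2), of u r] r that by simp
    show "word_proj JJ \<in> borel_measurable \<mu>" by (rule measurable_word_proj[OF S J \<mu>])
    show "cylinder n u \<in> sets \<mu>" if "u \<in> {[]}" for u by (simp only: \<mu> cylinder_sets)
    show "disjoint_family_on (cylinder n) {[]}" by (simp add: disjoint_family_on_def)
  qed (use r fin pos q B in \<open>auto simp: cylinder_Nil space_eq c_def\<close>)
  note bound = this
  show thesis by (rule that, unfold image_measure_def, rule bound[unfolded d_def])
qed

lemma mesh_quotient_le_cut_sum:
  fixes s :: real
  assumes s: "0 < s" "s \<le> CARD('n)" and c: "0 < c"
  obtains K where "\<And>r. 0 < r \<Longrightarrow> r < 1 \<Longrightarrow>
    (if q < 1 then cut_sum n T \<mu> q s r \<le> c else c \<le> cut_sum n T \<mu> q s r) \<Longrightarrow>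
    mesh_quotient q (image_measure JJ \<mu>) r \<le> ereal (s + K / (- ln r))"
proof -
  define d where "d = CARD('n)"
  obtain R where R: "0 < R" "\<And>x. x \<in> J \<Longrightarrow> norm x \<le> R"
    using compact_imp_bounded[OF J(1)] by (auto simp: bounded_pos)
  \<comment> \<open>The mesh cubes per cell of the rotated grid, times the constant of
    \<open>box_count_le_sv_fun\<close>.\<close>
  define B where "B = real (2 * d + 1) ^ d * ((2 * R + 2 / a) ^ d / a)"
  have B: "0 < B" using R a by (simp add: B_def add_pos_pos)
  have m: "min (nat \<lceil>s\<rceil>) CARD('n) \<in> {1..CARD('n)}" using nat_ceiling_mem[OF s] by auto
  have fw: "u \<in> finite_words n" if "u \<in> cut_set n T s r" for u r
    using that by (simp add: cut_set_eq_cut cut_def)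
  have "mesh_quotient q (distr \<mu> borel (word_proj JJ)) r \<le> ereal (s +
      (if q = 1 then measure \<mu> (space \<mu>) * ln B - c else ln B - ln c / (q - 1)) / (- ln r))"
    if r: "0 < r" "r < 1" and F: "if q < 1 then cut_sum n T \<mu> q s r \<le> c else c \<le> cut_sum n T \<mu> q s r" for r
  proof (rule mesh_quotient_le_partition[where U = "cut_set n T s r" and C = "cylinder n"
        and \<psi> = "\<lambda>u. sv_fun s (word_matrix T u)" and F = "cut_sum n T \<mu> q s r"])
    fix u assume u: "u \<in> cut_set n T s r"
    have "real (card (mesh_index r ` word_proj JJ ` cylinder n u)) \<le> real (2 * d + 1) ^ d *
        (\<Prod>i=1..d. 2 * (singular_value i (word_matrix T u) * R) / r + 2)"
      using card_mesh_index_cylinder(2)[OF S J R(2) fw[OF u] r(1)] by (simp add: d_def)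
    also have "\<dots> \<le> real (2 * d + 1) ^ d * (((2 * R + 2 / a) ^ d / a) * sv_fun s (word_matrix T u) * r powr (- s))"
      using box_count_le_sv_fun[OF s r(1) _ u, of R] R(1) by (intro mult_left_mono) (auto simp: d_def)
    finally show "real (card (mesh_index r ` word_proj JJ ` cylinder n u))
        \<le> B * sv_fun s (word_matrix T u) * r powr (- s)" by (simp add: B_def mult.assoc)
    show "finite (mesh_index r ` word_proj JJ ` cylinder n u)"
      by (rule card_mesh_index_cylinder(1)[OF S J R(2) fw[OF u] r(1)])
    show "0 < sv_fun s (word_matrix T u)" by (rule sv_fun_pos[OF s fw[OF u]])
    show "cylinder n u \<in> sets \<mu>" by (simp add: \<mu> cylinder_sets)
  next
    show "word_proj JJ \<in> borel_measurable \<mu>" by (rule measurable_word_proj[OF S J \<mu>])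
    show "finite (cut_set n T s r)" "disjoint_family_on (cylinder n) (cut_set n T s r)"
      "(\<Union>u\<in>cut_set n T s r. cylinder n u) = space \<mu>"
      unfolding cut_set_eq_cut space_eq using finite_cut[OF m r(1)] cut_partition[OF m r] by auto
    show "if q < 1 then cut_sum n T \<mu> q s r \<le> c else c \<le> cut_sum n T \<mu> q s r" by (rule F)
  qed (use r fin pos q B s c in \<open>auto simp: cut_sum_def\<close>)
  note bound = this
  show thesis by (rule that, unfold image_measure_def, rule bound)
qed

lemma upper_dim_le_dimension: "upper_dim q (image_measure JJ \<mu>) \<le> ereal (real CARD('n))"
  and lower_dim_le_dimension: "lower_dim q (image_measure JJ \<mu>) \<le> ereal (real CARD('n))"
proof -
  obtain K where "\<And>r. 0 < r \<Longrightarrow> r < 1 \<Longrightarrow>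
      mesh_quotient q (image_measure JJ \<mu>) r \<le> ereal (real CARD('n) + K / (- ln r))"
    using mesh_quotient_le_dimension by blast
  note lim = Limsup_Liminf_at_right_le_of_ln_error[of "\<lambda>_. True", OF this]
  show "upper_dim q (image_measure JJ \<mu>) \<le> ereal (real CARD('n))"
    unfolding upper_dim_def by (rule lim(1)) auto
  show "lower_dim q (image_measure JJ \<mu>) \<le> ereal (real CARD('n))"
    unfolding lower_dim_def by (rule lim(2)) auto
qed

lemma dim_le_of_cut_sum_bound:
  fixes s :: real
  assumes s: "0 < s" "s \<le> CARD('n)" and c: "0 < c"
  defines "P \<equiv> \<lambda>r. if q < 1 then cut_sum n T \<mu> q s r \<le> c else c \<le> cut_sum n T \<mu> q s r"
  shows "eventually P (at_right 0) \<Longrightarrow> upper_dim q (image_measure JJ \<mu>) \<le> ereal s"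
    "frequently P (at_right 0) \<Longrightarrow> lower_dim q (image_measure JJ \<mu>) \<le> ereal s"
proof -
  obtain K where "\<And>r. 0 < r \<Longrightarrow> r < 1 \<Longrightarrow> P r \<Longrightarrow>
      mesh_quotient q (image_measure JJ \<mu>) r \<le> ereal (s + K / (- ln r))"
    using mesh_quotient_le_cut_sum[OF s c] unfolding P_def by blast
  note lim = Limsup_Liminf_at_right_le_of_ln_error[of P, OF this]
  show "eventually P (at_right 0) \<Longrightarrow> upper_dim q (image_measure JJ \<mu>) \<le> ereal s"
    "frequently P (at_right 0) \<Longrightarrow> lower_dim q (image_measure JJ \<mu>) \<le> ereal s"
    unfolding upper_dim_def lower_dim_def using lim by blast+
qed

text \<open>If q >= 1, an s outside the defining set has lower limit infinity, so the cut sum is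
  eventually at least 1. If q < 1, an s inside it has finite upper limit, so the cut sum is
  eventually bounded above. Either way the estimate holds for all small r.\<close>

lemma upper_dim_le_crit_plus: "upper_dim q (image_measure JJ \<mu>) \<le> crit_plus n T \<mu> q"
proof (cases "1 \<le> q")
  case True
  show ?thesis unfolding crit_plus_def if_P[OF True]
  proof (rule le_Sup_crit[OF _ upper_dim_le_dimension])
    fix s assume s: "0 < s" "s \<le> real CARD('n)" "\<not> Liminf (at_right 0) (\<lambda>r. ereal (cut_sum n T \<mu> q s r)) < \<infinity>"
    then have "ereal 1 < Liminf (at_right 0) (\<lambda>r. ereal (cut_sum n T \<mu> q s r))" by simp
    then have "eventually (\<lambda>r. 1 \<le> cut_sum n T \<mu> q s r) (at_right 0)"
      by (auto dest!: less_LiminfD elim: eventually_mono)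
    with True show "upper_dim q (image_measure JJ \<mu>) \<le> ereal s"
      by (intro dim_le_of_cut_sum_bound(1)[OF s(1,2) zero_less_one]) simp
  qed
next
  case False
  show ?thesis unfolding crit_plus_def if_not_P[OF False]
  proof (rule le_Inf_crit[OF _ upper_dim_le_dimension])
    fix s assume s: "0 < s" "s \<le> real CARD('n)" "Limsup (at_right 0) (\<lambda>r. ereal (cut_sum n T \<mu> q s r)) < \<infinity>"
    obtain c where c: "0 < c" "Limsup (at_right 0) (\<lambda>r. ereal (cut_sum n T \<mu> q s r)) < ereal c"
      using ereal_less_PInf_bound[OF s(3)] .
    have "eventually (\<lambda>r. cut_sum n T \<mu> q s r \<le> c) (at_right 0)"
      using Limsup_lessD[OF c(2)] by eventually_elim simp
    with False show "upper_dim q (image_measure JJ \<mu>) \<le> ereal s"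
      by (intro dim_le_of_cut_sum_bound(1)[OF s(1,2) c(1)]) simp
  qed
qed

text \<open>With the two limits exchanged, the same bounds are available only at arbitrarily small
  r, which is what a lower limit requires.\<close>

lemma lower_dim_le_crit_minus: "lower_dim q (image_measure JJ \<mu>) \<le> crit_minus n T \<mu> q"
proof (cases "1 \<le> q")
  case True
  show ?thesis unfolding crit_minus_def if_P[OF True]
  proof (rule le_Sup_crit[OF _ lower_dim_le_dimension])
    fix s assume s: "0 < s" "s \<le> real CARD('n)" "\<not> Limsup (at_right 0) (\<lambda>r. ereal (cut_sum n T \<mu> q s r)) < \<infinity>"
    have "frequently (\<lambda>r. 1 \<le> cut_sum n T \<mu> q s r) (at_right 0)"
      unfolding frequently_def
    proof
      assume "eventually (\<lambda>r. \<not> 1 \<le> cut_sum n T \<mu> q s r) (at_right 0)"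
      then have "eventually (\<lambda>r. ereal (cut_sum n T \<mu> q s r) \<le> 1) (at_right 0)"
        by eventually_elim simp
      from Limsup_bounded[OF this] s(3) show False by auto
    qed
    with True show "lower_dim q (image_measure JJ \<mu>) \<le> ereal s"
      by (intro dim_le_of_cut_sum_bound(2)[OF s(1,2) zero_less_one]) simp
  qed
next
  case False
  show ?thesis unfolding crit_minus_def if_not_P[OF False]
  proof (rule le_Inf_crit[OF _ lower_dim_le_dimension])
    fix s assume s: "0 < s" "s \<le> real CARD('n)" "Liminf (at_right 0) (\<lambda>r. ereal (cut_sum n T \<mu> q s r)) < \<infinity>"
    obtain c where c: "0 < c" "Liminf (at_right 0) (\<lambda>r. ereal (cut_sum n T \<mu> q s r)) < ereal c"
      using ereal_less_PInf_bound[OF s(3)] .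
    have "frequently (\<lambda>r. cut_sum n T \<mu> q s r \<le> c) (at_right 0)"
      unfolding frequently_def
    proof
      assume "eventually (\<lambda>r. \<not> cut_sum n T \<mu> q s r \<le> c) (at_right 0)"
      then have "eventually (\<lambda>r. ereal c \<le> ereal (cut_sum n T \<mu> q s r)) (at_right 0)"
        by eventually_elim simp
      from Liminf_bounded[OF this] c(2) show False by simp
    qed
    with False show "lower_dim q (image_measure JJ \<mu>) \<le> ereal s"
      by (intro dim_le_of_cut_sum_bound(2)[OF s(1,2) c(1)]) simp
  qed
qed

end

end

theorem theorem2p8:
  fixes n :: "nat \<Rightarrow> nat"
    and T :: "nat \<Rightarrow> nat \<Rightarrow> real^'n^'n"
    and J :: "(real^'n) set"
    and \<omega> :: "nat list \<Rightarrow> real^'n"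
    and JJ :: "nat list \<Rightarrow> (real^'n) set"
    and \<mu> :: "(nat \<Rightarrow> nat) measure"
    and q :: real
  assumes "\<And>k. 1 \<le> k \<Longrightarrow> 2 \<le> n k"
    and "\<And>k i. 1 \<le> k \<Longrightarrow> i \<in> {1..n k} \<Longrightarrow> onorm ((*v) (T k i)) < 1"
    and "\<And>k i. 1 \<le> k \<Longrightarrow> i \<in> {1..n k} \<Longrightarrow> invertible (T k i)"
    and "0 < sv_inf n T" and "sv_inf n T \<le> sv_sup n T" and "sv_sup n T < 1"
    and "compact J" and "interior J \<noteq> {}"
    and "nonautonomous_structure n T J \<omega> JJ"
    and "sets \<mu> = sets (restrict_space borel (infinite_words n))"
    and "finite_measure \<mu>" and "0 < measure \<mu> (space \<mu>)"
    and "0 < q"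
    and "q = 1 \<Longrightarrow> measure \<mu> (space \<mu>) \<le> 1"
  shows "upper_dim q (image_measure JJ \<mu>) \<le> min (crit_plus n T \<mu> q) (ereal (real CARD('n)))
       \<and> lower_dim q (image_measure JJ \<mu>) \<le> min (crit_minus n T \<mu> q) (ereal (real CARD('n)))"
proof -
  let ?I = "Sigma {1..} (\<lambda>k. {1..n k})"
  have nn: "0 \<le> singular_value m A" if "m \<in> {1..CARD('n)}" for m and A :: "real^'n^'n"
    using that by (rule singular_value_nonneg)
  have lt1: "singular_value 1 (T k i) \<le> 1" if "1 \<le> k" "i \<in> {1..n k}" for k i
  proof -
    have "norm (T k i *v x) \<le> 1 * norm x" for x
    proof -
      have "norm (T k i *v x) \<le> onorm ((*v) (T k i)) * norm x"
        by (rule onorm[OF matrix_vector_mul_bounded_linear])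
      also have "\<dots> \<le> 1 * norm x" using assms(2)[OF that] by (intro mult_right_mono) auto
      finally show ?thesis .
    qed
    then show ?thesis by (rule singular_value_1_le)
  qed
  \<comment> \<open>A real infimum or supremum bounds its family only if the family is bounded; 0
    and the operator norm bound provide this.\<close>
  have bb: "bdd_below ((\<lambda>(k, i). singular_value CARD('n) (T k i)) ` ?I)"
    by (rule bdd_belowI[of _ 0]) (auto intro!: nn)
  have ba: "bdd_above ((\<lambda>(k, i). singular_value 1 (T k i)) ` ?I)"
    by (rule bdd_aboveI[of _ 1]) (use lt1 in auto)
  interpret matrix_family n T "sv_inf n T" "sv_sup n T"
  proof
    fix k i assume ki: "1 \<le> k" "i \<in> {1..n k}"
    then have mem: "(k, i) \<in> ?I" by simp
    show "sv_inf n T \<le> singular_value CARD('n) (T k i)"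
      using cINF_lower[OF bb mem] by (simp add: sv_inf_def)
    show "singular_value 1 (T k i) \<le> sv_sup n T"
      using cSUP_upper[OF mem ba] by (simp add: sv_sup_def)
    show "invertible (T k i)" using ki by (rule assms(3))
  next
    fix k :: nat assume "1 \<le> k"
    then show "1 \<le> n k" using assms(1)[of k] by simp
  qed (use assms in auto)
  have J: "J \<noteq> {}" using assms(8) interior_empty by blast
  note a = assms(7) J assms(9-14)
  show ?thesis
    using upper_dim_le_crit_plus[OF a] lower_dim_le_crit_minus[OF a]
      upper_dim_le_dimension[OF a] lower_dim_le_dimension[OF a] by simp
qed

end
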